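(* Let $\alpha\in(0,1)$ and let $g:\mathbb{R}\to\mathbb{R}$ be continuously differentiable. Assume: (1) (dissipativity) there exist $a,b>0$ such that $g(x)\,x\le a-bx^2$ for all $x\in\mathbb{R}$; (2) (non-degeneracy) $g'(x)\neq 0$ for every $x\in\mathcal N(g):=\{x\in\mathbb{R}: g(x)=0\}$. Consider the scalar Caputo fractional differential equation ${}^{C}\!D^{\alpha}_{0+}x(t)=g(x(t))$, $t\ge 0$, and for $\eta\in\mathbb{R}$ let $x(\cdot,\eta)$ denote its solution with $x(0,\eta)=\eta$. Then: (i) The global attractor, attracting all solutions starting from a bounded set, is $\mathcal A=[\min\mathcal N(g),\max\mathcal N(g)]$. (ii) Each solution converges, as $t\to\infty$, to an element of $\mathcal N(g)$, and the rate of convergence is $t^{-\alpha}$. (iii) Each pair of successive elements $p<q$ of $\mathcal N(g)$ (that is, $p,q\in\mathcal N(g)$ and $\mathcal N(g)\cap(p,q)=\emptyset$) is joined by a heteroclinic solution: there is $\eta\in(p,q)$ such that $x(t,\eta)$ is defined for all $t\in\mathbb{R}$, and one of the limits $\lim_{t\to-\infty}x(t,\eta)$, $\lim_{t\to+\infty}x(t,\eta)$ equals $p$ and the other equals $q$.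
   Context: A solution of ${}^{C}\!D^{\alpha}_{0+}x(t)=g(x(t))$ with $x(0)=\eta$ is a continuous function $x(\cdot,\eta):[0,\infty)\to\mathbb{R}$ satisfying the integral equation $$x(t,\eta)=\eta+\frac{1}{\Gamma(\alpha)}\int_0^t (t-s)^{\alpha-1}g(x(s,\eta))\,ds,\qquad t\ge 0,$$ where $\Gamma$ is the Gamma function. Under the stated assumptions such a solution exists and is unique for every $\eta\in\mathbb{R}$, and $\mathcal N(g)$ is a finite set with an odd number of elements. For $B\subseteq\mathbb{R}$ put $x(t,B):=\{x(t,\eta):\eta\in B\}$. A nonempty compact set $\mathcal A\subset\mathbb{R}$ is the global attractor if $x(t,\mathcal A)=\mathcal A$ for all $t\ge 0$ and, for every nonempty bounded $B\subset\mathbb{R}$, $\lim_{t\to\infty}\sup_{\eta\in B}\inf_{z\in\mathcal A}|x(t,\eta)-z|=0$. "The rate of convergence is $t^{-\alpha}$" means: for every $\eta\notin\mathcal N(g)$, with $x^*:=\lim_{t\to\infty}x(t,\eta)$, there are constants $c,C,T>0$ such that $c\,t^{-\alpha}\le|x(t,\eta)-x^*|\le C\,t^{-\alpha}$ for all $t\ge T$. (For $\eta\in\mathcal N(g)$ the solution is constant.) Extension to negative time: for $t<0$, $x(t,\eta)$ denotes the unique $\zeta\in\mathbb{R}$, when it exists, such that $x(-t,\zeta)=\eta$. *)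

theory Defs
  imports "HOL-Analysis.Analysis"
begin

definition zeros :: "(real \<Rightarrow> real) \<Rightarrow> real set" where
  "zeros g = {x. g x = 0}"

text \<open>
  Solutions on the half line of the Caputo equation of order \<open>\<alpha>\<close> with right-hand side \<open>g\<close> and
  initial value \<open>\<eta>\<close>, in Volterra integral form.  The values of \<open>y\<close> at negative arguments are
  irrelevant.  For \<open>0 < \<alpha>\<close> and continuous \<open>g\<close> and \<open>y\<close> the integrand is absolutely integrable (with
  value 0 at \<open>s = t\<close>, since \<open>0 powr _ = 0\<close>), so the Henstock--Kurzweil integral is the Lebesgue one.
\<close>

definition caputo_solution :: "real \<Rightarrow> (real \<Rightarrow> real) \<Rightarrow> real \<Rightarrow> (real \<Rightarrow> real) \<Rightarrow> bool" where
  "caputo_solution \<alpha> g \<eta> y \<longleftrightarrow>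
     continuous_on {0..} y \<and>
     (\<forall>t\<ge>0. y t = \<eta> + 1 / Gamma \<alpha> * integral {0..t} (\<lambda>s. (t - s) powr (\<alpha> - 1) * g (y s)))"

text \<open>
  \<open>caputo_value \<alpha> g t \<eta> v\<close> says that \<open>v\<close> is a possible value of \<open>x(t,\<eta>)\<close>: for \<open>t \<ge> 0\<close> some solution
  starting at \<open>\<eta>\<close> takes the value \<open>v\<close> at time \<open>t\<close>; for \<open>t < 0\<close> some solution starting at \<open>v\<close> takes
  the value \<open>\<eta>\<close> at time \<open>-t\<close>.  Then \<open>x(t,\<eta>)\<close> is defined if there is exactly one such \<open>v\<close>.
\<close>

definition caputo_value :: "real \<Rightarrow> (real \<Rightarrow> real) \<Rightarrow> real \<Rightarrow> real \<Rightarrow> real \<Rightarrow> bool" where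
  "caputo_value \<alpha> g t \<eta> v \<longleftrightarrow>
     (if 0 \<le> t then \<exists>y. caputo_solution \<alpha> g \<eta> y \<and> y t = v
      else \<exists>y. caputo_solution \<alpha> g v y \<and> y (- t) = \<eta>)"

definition caputo_defined :: "real \<Rightarrow> (real \<Rightarrow> real) \<Rightarrow> real \<Rightarrow> real \<Rightarrow> bool" where
  "caputo_defined \<alpha> g t \<eta> \<longleftrightarrow> (\<exists>!v. caputo_value \<alpha> g t \<eta> v)"

definition caputo_flow :: "real \<Rightarrow> (real \<Rightarrow> real) \<Rightarrow> real \<Rightarrow> real \<Rightarrow> real" where
  "caputo_flow \<alpha> g t \<eta> = (THE v. caputo_value \<alpha> g t \<eta> v)"

text \<open>The supremum is taken in \<^typ>\<open>ereal\<close>, so that it is meaningful also when it is infinite.\<close>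

definition global_attractor :: "(real \<Rightarrow> real \<Rightarrow> real) \<Rightarrow> real set \<Rightarrow> bool" where
  "global_attractor x A \<longleftrightarrow>
     A \<noteq> {} \<and> compact A \<and>
     (\<forall>t\<ge>0. x t ` A = A) \<and>
     (\<forall>B. B \<noteq> {} \<and> bounded B \<longrightarrow>
        ((\<lambda>t. SUP \<eta>\<in>B. ereal (infdist (x t \<eta>) A)) \<longlongrightarrow> 0) at_top)"

definition rate_of_convergence :: "real \<Rightarrow> (real \<Rightarrow> real) \<Rightarrow> real \<Rightarrow> bool" where
  "rate_of_convergence \<alpha> f L \<longleftrightarrow>
     (\<exists>c C T. 0 < c \<and> 0 < C \<and> 0 < T \<and>
        (\<forall>t\<ge>T. c * t powr (- \<alpha>) \<le> \<bar>f t - L\<bar> \<and> \<bar>f t - L\<bar> \<le> C * t powr (- \<alpha>)))"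

end

theory Submission
  imports Defs
begin

text \<open>
  Write \<open>J \<psi> t = \<integral>\<^sub>0\<^sup>t (t - s)\<^sup>\<alpha>\<^sup>-\<^sup>1 \<psi>(s) ds\<close>.  With \<open>G = g / \<Gamma>(\<alpha>)\<close> the equation becomes
  \<open>x = \<eta> + J (G \<circ> x)\<close>, and everything rests on comparing its solutions with those of one linear
  equation.  The relaxation function \<open>u\<close> of rate \<open>l > 0\<close> solves \<open>u = 1 - l J u\<close>; it is the
  Mittag-Leffler function \<open>E\<^sub>\<alpha>(- l \<Gamma>(\<alpha>) t\<^sup>\<alpha>)\<close>, and its properties are derived from this equation.

  The power kernel is log-convex, and an argument at the first zero
  (\<open>positive_if_source_decays_slower\<close>) turns this into positivity of \<open>u\<close> and of
  \<open>u(t) - u(t + h)\<close>, that is, into monotonicity of \<open>u\<close>.  If \<open>z = c + J \<psi>\<close>, then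
  convolution with \<open>u\<close> and one application of Fubini's theorem (\<open>abel_integral_convolution\<close>) give
  \<open>\<integral>\<^sub>0\<^sup>t (z - c u) = (1/l) \<integral>\<^sub>0\<^sup>t (1 - u(t - r)) (\<psi>(r) + l z(r)) dr\<close>.  When
  \<open>\<psi> \<ge> - l z\<close>, the right-hand side is nondecreasing in \<open>t\<close> because \<open>u\<close> decreases, and
  differentiation yields \<open>z \<ge> c u\<close>.  This comparison principle (\<open>comparison_with_relaxation\<close>)
  shows that solutions with different initial values never meet and that constants at which \<open>G\<close> has
  the appropriate sign are barriers.  So Picard iteration for a truncated field yields solutions of the
  original equation on the half line; a singular Gronwall inequality gives uniqueness and continuity
  in \<open>\<eta>\<close>.

  Let \<open>G > 0\<close> on \<open>[\<eta>, q)\<close> and \<open>G q = 0\<close>.  Nondegeneracy of the zero bounds \<open>G y\<close> on \<open>[\<eta>, q]\<close> between two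
  positive multiples \<open>k (q - y)\<close> and \<open>K (q - y)\<close>, and \<open>w = q - x\<close> satisfies
  \<open>w = (q - \<eta>) - J (G \<circ> x)\<close>.  So \<open>w\<close> lies between multiples of the relaxation functions of rates \<open>K\<close>
  and \<open>k\<close> (\<open>relaxation_bounds\<close>), and both are of exact order \<open>t\<^sup>-\<^sup>\<alpha>\<close>
  (\<open>relaxation_upper_rate\<close>, \<open>relaxation_lower_rate\<close>).  The reflection \<open>y \<mapsto> - G (- y)\<close> covers the
  other sign, which settles convergence and its rate.

  The other two claims follow from order preservation.  A bounded set of initial values is squeezed
  between two solutions, each converging to a zero, and the intermediate value theorem gives the
  invariance of the interval spanned by the zeros.  Between consecutive zeros \<open>p < q\<close> the time-\<open>t\<close> map
  is a bijection of \<open>[p, q]\<close>, so every \<open>\<eta>\<close> in between has a unique starting point \<open>\<zeta>(t)\<close> from which it is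
  reached at time \<open>t\<close>; if orbits rise to \<open>q\<close>, then any fixed \<open>\<xi> > p\<close> is eventually carried above \<open>\<eta>\<close>, which
  forces \<open>\<zeta>(t) < \<xi>\<close>, and so \<open>\<zeta>(t)\<close> tends to \<open>p\<close>.
\<close>

section \<open>Abel integrals\<close>

text \<open>
  This is \<open>\<Gamma>(\<alpha>)\<close> times the Riemann--Liouville integral of order \<open>\<alpha>\<close>; leaving the factor \<open>1/\<Gamma>(\<alpha>)\<close> to the
  right-hand side of the equation keeps the Gamma function out of all estimates.
\<close>

definition abel_integral :: "real \<Rightarrow> (real \<Rightarrow> real) \<Rightarrow> real \<Rightarrow> real" where
  "abel_integral \<alpha> \<psi> t = integral {0..t} (\<lambda>s. (t - s) powr (\<alpha> - 1) * \<psi> s)"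

locale fractional_order =
  fixes \<alpha> :: real
  assumes order_pos: "0 < \<alpha>" and order_less_1: "\<alpha> < 1"
begin

abbreviation J :: "(real \<Rightarrow> real) \<Rightarrow> real \<Rightarrow> real" where "J \<equiv> abel_integral \<alpha>"

lemma kernel_has_integral:
  assumes "a \<le> b" "b \<le> t"
  shows "((\<lambda>s. (t - s) powr (\<alpha> - 1)) has_integral
           ((t - a) powr \<alpha> - (t - b) powr \<alpha>) / \<alpha>) {a..b}"
proof -
  have "((\<lambda>s. (t - s) powr (\<alpha> - 1)) has_integral
          (- ((t - b) powr \<alpha>) / \<alpha>) - (- ((t - a) powr \<alpha>) / \<alpha>)) {a..b}"
  proof (rule fundamental_theorem_of_calculus_interior[OF assms(1)])
    show "continuous_on {a..b} (\<lambda>s. - ((t - s) powr \<alpha>) / \<alpha>)"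
      using assms order_pos by (intro continuous_intros continuous_on_powr') auto
    fix s assume s: "s \<in> {a<..<b}"
    have "((\<lambda>s. - ((t - s) powr \<alpha>) / \<alpha>) has_real_derivative (t - s) powr (\<alpha> - 1)) (at s)"
      using s assms order_pos by (auto intro!: derivative_eq_intros)
    then show "((\<lambda>s. - ((t - s) powr \<alpha>) / \<alpha>) has_vector_derivative (t - s) powr (\<alpha> - 1)) (at s)"
      by (simp add: has_real_derivative_iff_has_vector_derivative)
  qed
  then show ?thesis by (simp add: diff_divide_distrib)
qed

lemma kernel_mult_absolutely_integrable:
  assumes "continuous_on {a..b} \<psi>" "b \<le> t"
  shows "(\<lambda>s. (t - s) powr (\<alpha> - 1) * \<psi> s) absolutely_integrable_on {a..b}"
proof (cases "a \<le> b")
  case True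
  have k: "(\<lambda>s. (t - s) powr (\<alpha> - 1)) absolutely_integrable_on {a..b}"
    using kernel_has_integral[OF True assms(2)]
    by (intro nonnegative_absolutely_integrable_1) (auto simp: integrable_on_def)
  have "(\<lambda>s. \<psi> s * (t - s) powr (\<alpha> - 1)) absolutely_integrable_on {a..b}"
  proof (rule absolutely_integrable_bounded_measurable_product_real[OF _ _ _ k])
    show "\<psi> \<in> borel_measurable (lebesgue_on {a..b})"
      using assms(1) by (intro continuous_imp_measurable_on_sets_lebesgue) auto
    show "bounded (\<psi> ` {a..b})"
      using assms(1) by (intro compact_imp_bounded compact_continuous_image) auto
  qed auto
  then show ?thesis by (simp add: mult.commute)
qed auto

lemma kernel_mult_integrable:
  assumes "continuous_on {a..b} \<psi>" "b \<le> t"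
  shows "(\<lambda>s. (t - s) powr (\<alpha> - 1) * \<psi> s) integrable_on {a..b}"
  using kernel_mult_absolutely_integrable[OF assms]
  by (rule set_lebesgue_integral_eq_integral(1))

lemma abel_integral_mono:
  assumes "continuous_on {0..t} \<phi>" "continuous_on {0..t} \<psi>"
    and "\<And>s. 0 \<le> s \<Longrightarrow> s \<le> t \<Longrightarrow> \<phi> s \<le> \<psi> s"
  shows "J \<phi> t \<le> J \<psi> t"
  unfolding abel_integral_def
  using assms by (intro integral_le kernel_mult_integrable) (auto intro!: mult_left_mono)

lemma abel_integral_cong:
  assumes "\<And>s. 0 \<le> s \<Longrightarrow> s \<le> t \<Longrightarrow> \<phi> s = \<psi> s"
  shows "J \<phi> t = J \<psi> t"
  unfolding abel_integral_def using assms by (intro integral_cong) auto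

lemma abel_integral_add:
  assumes "continuous_on {0..t} \<phi>" "continuous_on {0..t} \<psi>"
  shows "J (\<lambda>s. \<phi> s + \<psi> s) t = J \<phi> t + J \<psi> t"
  unfolding abel_integral_def
  using integral_add[OF kernel_mult_integrable[OF assms(1) order_refl] kernel_mult_integrable[OF assms(2) order_refl]]
  by (simp add: algebra_simps)

lemma abel_integral_cmult: "J (\<lambda>s. c * \<psi> s) t = c * J \<psi> t"
proof -
  have "(\<lambda>s. (t - s) powr (\<alpha> - 1) * (c * \<psi> s)) = (\<lambda>s. c * ((t - s) powr (\<alpha> - 1) * \<psi> s))"
    by (simp add: fun_eq_iff)
  then show ?thesis unfolding abel_integral_def by (simp only: integral_mult_right)
qed

lemma abel_integral_diff:
  assumes "continuous_on {0..t} \<phi>" "continuous_on {0..t} \<psi>"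
  shows "J (\<lambda>s. \<phi> s - \<psi> s) t = J \<phi> t - J \<psi> t"
  unfolding abel_integral_def
  using integral_diff[OF kernel_mult_integrable[OF assms(1) order_refl] kernel_mult_integrable[OF assms(2) order_refl]]
  by (simp add: algebra_simps)

lemma abel_integral_minus: "J (\<lambda>s. - \<psi> s) t = - J \<psi> t"
  using abel_integral_cmult[of "-1" \<psi> t] by simp

lemma abel_integral_abs_le:
  assumes "continuous_on {0..t} \<psi>"
  shows "\<bar>J \<psi> t\<bar> \<le> J (\<lambda>s. \<bar>\<psi> s\<bar>) t"
proof -
  have "J \<psi> t \<le> J (\<lambda>s. \<bar>\<psi> s\<bar>) t"
    using assms by (intro abel_integral_mono continuous_intros) auto
  moreover have "J (\<lambda>s. - \<psi> s) t \<le> J (\<lambda>s. \<bar>\<psi> s\<bar>) t"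
    using assms by (intro abel_integral_mono continuous_intros) auto
  ultimately show ?thesis by (simp add: abel_integral_minus)
qed

lemma abel_integral_const: "0 \<le> t \<Longrightarrow> J (\<lambda>s. c) t = c * t powr \<alpha> / \<alpha>"
  using integral_unique[OF kernel_has_integral[of 0 t t]]
  unfolding abel_integral_def by simp

lemma abel_integral_zero [simp]: "J \<psi> 0 = 0"
  unfolding abel_integral_def by simp

lemma abel_integral_split:
  assumes "continuous_on {0..t} \<psi>" "0 \<le> r" "r \<le> t"
  shows "J \<psi> t = integral {0..r} (\<lambda>s. (t - s) powr (\<alpha> - 1) * \<psi> s)
                + integral {r..t} (\<lambda>s. (t - s) powr (\<alpha> - 1) * \<psi> s)"
  unfolding abel_integral_def
  using Henstock_Kurzweil_Integration.integral_combine[OF assms(2,3) kernel_mult_integrable[OF assms(1) order_refl]] by simp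

lemma kernel_integral_le:
  assumes "continuous_on {a..b} \<psi>" "a \<le> b" "b \<le> t" "\<And>s. a \<le> s \<Longrightarrow> s \<le> b \<Longrightarrow> \<psi> s \<le> M"
  shows "integral {a..b} (\<lambda>s. (t - s) powr (\<alpha> - 1) * \<psi> s)
           \<le> M * ((t - a) powr \<alpha> - (t - b) powr \<alpha>) / \<alpha>"
proof -
  have "integral {a..b} (\<lambda>s. (t - s) powr (\<alpha> - 1) * \<psi> s)
          \<le> integral {a..b} (\<lambda>s. (t - s) powr (\<alpha> - 1) * M)"
    using assms by (intro integral_le kernel_mult_integrable) (auto intro!: mult_left_mono)
  also have "\<dots> = M * ((t - a) powr \<alpha> - (t - b) powr \<alpha>) / \<alpha>"
    using integral_unique[OF kernel_has_integral[OF assms(2,3)]] by simp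
  finally show ?thesis .
qed

lemma kernel_antimono:
  assumes "0 < x" "x \<le> y" shows "y powr (\<alpha> - 1) \<le> x powr (\<alpha> - 1)"
  using assms order_less_1 by (intro powr_mono2') auto

text \<open>
  Going from \<open>t\<close> to \<open>t'\<close> changes the weight on \<open>[0, t]\<close> and adds the piece \<open>[t, t']\<close>.  As the kernel
  decreases, both changes are integrals of kernels without absolute values, and each is at most
  \<open>(t' - t)\<^sup>\<alpha> / \<alpha>\<close>, up to the factor \<open>M\<close> from \<open>\<psi>\<close>.
\<close>

lemma abel_integral_hoelder:
  assumes cont: "continuous_on {0..T} \<psi>" and M: "\<And>s. 0 \<le> s \<Longrightarrow> s \<le> T \<Longrightarrow> \<bar>\<psi> s\<bar> \<le> M"
    and t: "0 \<le> t" "t \<le> t'" "t' \<le> T"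
  shows "\<bar>J \<psi> t' - J \<psi> t\<bar> \<le> 2 * M * (t' - t) powr \<alpha> / \<alpha>"
proof -
  let ?k = "\<lambda>t s. (t - s) powr (\<alpha> - 1)"
  have M0: "0 \<le> M" using M[of t] t by auto
  have c1: "continuous_on {0..t} \<psi>" and c2: "continuous_on {t..t'} \<psi>" and c3: "continuous_on {0..t'} \<psi>"
    using cont t by (auto elim!: continuous_on_subset)
  have i1: "(\<lambda>s. ?k t' s * \<psi> s) integrable_on {0..t}" "(\<lambda>s. ?k t s * \<psi> s) integrable_on {0..t}"
    "(\<lambda>s. ?k t' s * \<psi> s) integrable_on {t..t'}"
    using c1 c2 t by (auto intro!: kernel_mult_integrable)
  have h1: "(?k t has_integral (t powr \<alpha>) / \<alpha>) {0..t}"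
    using kernel_has_integral[of 0 t t] t by simp
  have h2: "(?k t' has_integral (t' powr \<alpha> - (t' - t) powr \<alpha>) / \<alpha>) {0..t}"
    using kernel_has_integral[of 0 t t'] t by simp
  have h3: "((\<lambda>s. M * ?k t' s) has_integral M * ((t' - t) powr \<alpha> / \<alpha>)) {t..t'}"
    using has_integral_mult_right[OF kernel_has_integral[of t t' t'], of M] t by simp
  have h12: "((\<lambda>s. M * (?k t s - ?k t' s)) has_integral
      M * ((t powr \<alpha>) / \<alpha> - (t' powr \<alpha> - (t' - t) powr \<alpha>) / \<alpha>)) {0..t}"
    by (intro has_integral_mult_right has_integral_diff h1 h2)
  \<comment> \<open>At \<open>s = t\<close> the kernel takes the value \<open>0 powr (\<alpha> - 1) = 0\<close> and is not monotone, so that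
    point is removed.\<close>
  have b1: "norm (integral {0..t} (\<lambda>s. ?k t' s * \<psi> s - ?k t s * \<psi> s))
        \<le> integral {0..t} (\<lambda>s. M * \<bar>?k t s - ?k t' s\<bar>)"
  proof (rule integral_norm_bound_integral)
    show "(\<lambda>s. ?k t' s * \<psi> s - ?k t s * \<psi> s) integrable_on {0..t}"
      by (intro integrable_diff i1)
    have "(\<lambda>s. M * (?k t s - ?k t' s)) integrable_on {0..t}" using h12 by blast
    then show "(\<lambda>s. M * \<bar>?k t s - ?k t' s\<bar>) integrable_on {0..t}"
    proof (rule integrable_spike_finite[of "{t}", rotated 2])
      fix s assume "s \<in> {0..t} - {t}"
      then have "?k t' s \<le> ?k t s" using t by (intro kernel_antimono) auto
      then show "M * \<bar>?k t s - ?k t' s\<bar> = M * (?k t s - ?k t' s)" by simp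
    qed auto
    fix s assume s: "s \<in> {0..t}"
    have "norm (?k t' s * \<psi> s - ?k t s * \<psi> s) = \<bar>\<psi> s\<bar> * \<bar>?k t s - ?k t' s\<bar>"
      by (simp add: abs_mult[symmetric] algebra_simps abs_minus_commute)
    also have "\<dots> \<le> M * \<bar>?k t s - ?k t' s\<bar>" using s t M by (intro mult_right_mono) auto
    finally show "norm (?k t' s * \<psi> s - ?k t s * \<psi> s) \<le> M * \<bar>?k t s - ?k t' s\<bar>" .
  qed
  also have "integral {0..t} (\<lambda>s. M * \<bar>?k t s - ?k t' s\<bar>) = integral {0..t} (\<lambda>s. M * (?k t s - ?k t' s))"
  proof (rule integral_spike[of "{t}"])
    fix s assume "s \<in> {0..t} - {t}"
    then have "?k t' s \<le> ?k t s" using t by (intro kernel_antimono) auto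
    then show "M * (?k t s - ?k t' s) = M * \<bar>?k t s - ?k t' s\<bar>" by simp
  qed auto
  also have "\<dots> = M * ((t powr \<alpha>) / \<alpha> - (t' powr \<alpha> - (t' - t) powr \<alpha>) / \<alpha>)"
    using h12 by (rule integral_unique)
  finally have b1: "\<bar>integral {0..t} (\<lambda>s. ?k t' s * \<psi> s - ?k t s * \<psi> s)\<bar> \<le> \<dots>" by simp
  have b2: "norm (integral {t..t'} (\<lambda>s. ?k t' s * \<psi> s)) \<le> integral {t..t'} (\<lambda>s. M * ?k t' s)"
    by (rule integral_norm_bound_integral[OF i1(3)])
       (use h3 M t in \<open>auto simp: abs_mult mult.commute intro!: mult_right_mono\<close>)
  also have "\<dots> = M * ((t' - t) powr \<alpha> / \<alpha>)" using h3 by (rule integral_unique)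
  finally have b2: "\<bar>integral {t..t'} (\<lambda>s. ?k t' s * \<psi> s)\<bar> \<le> M * ((t' - t) powr \<alpha> / \<alpha>)" by simp
  have "J \<psi> t' - J \<psi> t = integral {0..t} (\<lambda>s. ?k t' s * \<psi> s - ?k t s * \<psi> s)
      + integral {t..t'} (\<lambda>s. ?k t' s * \<psi> s)"
    using abel_integral_split[OF c3 t(1,2)] integral_diff[OF i1(1,2)]
    by (simp add: abel_integral_def)
  then have "\<bar>J \<psi> t' - J \<psi> t\<bar> \<le> M * ((t powr \<alpha>) / \<alpha> - (t' powr \<alpha> - (t' - t) powr \<alpha>) / \<alpha>)
      + M * ((t' - t) powr \<alpha> / \<alpha>)" using b1 b2 by linarith
  also have "\<dots> = M * ((t powr \<alpha> - t' powr \<alpha>) + 2 * (t' - t) powr \<alpha>) / \<alpha>"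
    using order_pos by (simp add: field_simps)
  also have "\<dots> \<le> M * (2 * (t' - t) powr \<alpha>) / \<alpha>"
    using order_pos M0 t powr_mono2[of \<alpha> t t']
    by (intro divide_right_mono mult_left_mono) auto
  finally show ?thesis by (simp add: mult.assoc mult.left_commute)
qed

lemma abel_integral_continuous:
  assumes "continuous_on {0..T} \<psi>" shows "continuous_on {0..T} (J \<psi>)"
proof -
  have "bounded (\<psi> ` {0..T})"
    using assms by (intro compact_imp_bounded compact_continuous_image) auto
  then obtain M where M: "\<And>s. 0 \<le> s \<Longrightarrow> s \<le> T \<Longrightarrow> \<bar>\<psi> s\<bar> \<le> M"
    unfolding bounded_iff by force
  have H: "\<bar>J \<psi> t' - J \<psi> t\<bar> \<le> 2 * M * \<bar>t' - t\<bar> powr \<alpha> / \<alpha>" if "t \<in> {0..T}" "t' \<in> {0..T}" for t t'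
    using abel_integral_hoelder[OF assms M, of t t'] abel_integral_hoelder[OF assms M, of t' t] that
    by (cases "t \<le> t'") (auto simp: abs_minus_commute)
  show ?thesis unfolding continuous_on_def
  proof
    fix t assume t: "t \<in> {0..T}"
    have "((\<lambda>t'. 2 * M * \<bar>t' - t\<bar> powr \<alpha> / \<alpha>) \<longlongrightarrow> 2 * M * \<bar>t - t\<bar> powr \<alpha> / \<alpha>) (at t within {0..T})"
      using order_pos by (intro tendsto_intros tendsto_powr') auto
    then have "((\<lambda>t'. 2 * M * \<bar>t' - t\<bar> powr \<alpha> / \<alpha>) \<longlongrightarrow> 0) (at t within {0..T})" by simp
    then have "((\<lambda>t'. J \<psi> t' - J \<psi> t) \<longlongrightarrow> 0) (at t within {0..T})"
      by (rule Lim_null_comparison[rotated]) (use H t in \<open>auto simp: eventually_at_filter\<close>)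
    then show "(J \<psi> \<longlongrightarrow> J \<psi> t) (at t within {0..T})" by (simp add: LIM_zero_cancel)
  qed
qed

text \<open>
  Both sides are the integral of \<open>u(t - s) (s - r)\<^sup>\<alpha>\<^sup>-\<^sup>1 \<psi>(r)\<close> over the triangle \<open>0 \<le> r \<le> s \<le> t\<close>; the singular
  kernel is integrable there, so Fubini's theorem applies.
\<close>

lemma abel_integral_convolution:
  assumes t: "0 \<le> t" and u: "continuous_on {0..t} u" and \<psi>: "continuous_on {0..t} \<psi>"
  shows "integral {0..t} (\<lambda>s. u (t - s) * J \<psi> s) = integral {0..t} (\<lambda>r. J u (t - r) * \<psi> r)"
proof -
  \<comment> \<open>Cutting off outside \<open>[0, t]\<close> makes the functions Borel measurable on the whole line.\<close>
  define uu where "uu = (\<lambda>s. indicator {0..t} s *\<^sub>R u s)"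
  define pp where "pp = (\<lambda>s. indicator {0..t} s *\<^sub>R \<psi> s)"
  have [measurable]: "uu \<in> borel_measurable borel" "pp \<in> borel_measurable borel"
    unfolding uu_def pp_def by (rule borel_measurable_continuous_on_indicator[OF _ u] borel_measurable_continuous_on_indicator[OF _ \<psi>]; simp)+
  define f where "f s r = (if 0 \<le> r \<and> r \<le> s \<and> s \<le> t
      then uu (t - s) * ((s - r) powr (\<alpha> - 1) * pp r) else 0)" for s r
  have meas: "(\<lambda>(s, r). f s r) \<in> borel_measurable (lborel \<Otimes>\<^sub>M lborel)"
    unfolding f_def by measurable
  have cuts: "continuous_on {0..t} (\<lambda>s. u (t - s))"
    by (rule continuous_on_compose2[OF u]) (auto intro!: continuous_intros)
  have f_r: "f s r = indicator {0..s} r *\<^sub>R (u (t - s) * ((s - r) powr (\<alpha> - 1) * \<psi> r))" if "s \<in> {0..t}" for s r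
    using that by (auto simp: f_def uu_def pp_def indicator_def)
  have f_r0: "f s r = 0" if "s \<notin> {0..t}" for s r
    using that by (auto simp: f_def)
  have f_s: "f s r = indicator {r..t} s *\<^sub>R (((s - r) powr (\<alpha> - 1) * u (t - s)) * \<psi> r)" if "r \<in> {0..t}" for s r
    using that by (auto simp: f_def uu_def pp_def indicator_def)
  have f_s0: "f s r = 0" if "r \<notin> {0..t}" for s r
    using that by (auto simp: f_def)
  have int_r: "set_integrable lborel {0..s} (\<lambda>r. c * ((s - r) powr (\<alpha> - 1) * \<psi>' r))"
    and eq_r: "(LINT r:{0..s}|lborel. c * ((s - r) powr (\<alpha> - 1) * \<psi>' r)) = c * J \<psi>' s"
    if s: "s \<in> {0..t}" and \<psi>': "continuous_on {0..t} \<psi>'" for s c \<psi>'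
  proof -
    let ?h = "\<lambda>r. c * ((s - r) powr (\<alpha> - 1) * \<psi>' r)"
    have c: "continuous_on {0..s} \<psi>'" using \<psi>' s by (auto elim!: continuous_on_subset)
    have "?h absolutely_integrable_on {0..s}"
      using kernel_mult_absolutely_integrable[OF c order_refl] by (intro set_integrable_mult_right) auto
    moreover have "set_borel_measurable lborel {0..s} ?h"
    proof -
      have [measurable]: "(\<lambda>r. indicator {0..s} r *\<^sub>R \<psi>' r) \<in> borel_measurable borel"
        by (rule borel_measurable_continuous_on_indicator[OF _ c]) simp
      have "(\<lambda>r. c * ((s - r) powr (\<alpha> - 1) * (indicator {0..s} r *\<^sub>R \<psi>' r))) \<in> borel_measurable lborel"
        by measurable
      then show ?thesis unfolding set_borel_measurable_def
        by (rule measurable_cong[THEN iffD1, rotated]) (auto simp: indicator_def)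
    qed
    ultimately show I: "set_integrable lborel {0..s} ?h"
      unfolding set_integrable_def set_borel_measurable_def
      by (simp add: integrable_completion)
    have "(LINT r:{0..s}|lborel. ?h r) = integral {0..s} ?h"
      by (rule set_borel_integral_eq_integral(2)[OF I])
    also have "\<dots> = c * J \<psi>' s" by (simp add: abel_integral_def)
    finally show "(LINT r:{0..s}|lborel. ?h r) = c * J \<psi>' s" .
  qed
  have inner: "(\<integral>r. f s r \<partial>lborel) = indicator {0..t} s *\<^sub>R (u (t - s) * J \<psi> s)" for s
  proof (cases "s \<in> {0..t}")
    case True
    have "(\<integral>r. f s r \<partial>lborel) = (LINT r:{0..s}|lborel. u (t - s) * ((s - r) powr (\<alpha> - 1) * \<psi> r))"
      unfolding set_lebesgue_integral_def f_r[OF True] ..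
    then show ?thesis using True eq_r[OF True \<psi>] by simp
  next
    case False then show ?thesis using f_r0[OF False] by simp
  qed
  have c1: "continuous_on {0..t} (\<lambda>s. u (t - s) * J \<psi> s)"
    by (intro continuous_intros cuts abel_integral_continuous \<psi>)
  have c2: "continuous_on {0..t} (\<lambda>s. \<bar>u (t - s)\<bar> * J (\<lambda>s. \<bar>\<psi> s\<bar>) s)"
    by (intro continuous_intros cuts abel_integral_continuous \<psi>)
  have norm_inner: "(\<integral>r. norm (f s r) \<partial>lborel) = indicator {0..t} s *\<^sub>R (\<bar>u (t - s)\<bar> * J (\<lambda>s. \<bar>\<psi> s\<bar>) s)" for s
  proof (cases "s \<in> {0..t}")
    case True
    have "continuous_on {0..t} (\<lambda>s. \<bar>\<psi> s\<bar>)" by (intro continuous_intros \<psi>)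
    note eq = eq_r[OF True this]
    have "norm (f s r) = indicator {0..s} r *\<^sub>R (\<bar>u (t - s)\<bar> * ((s - r) powr (\<alpha> - 1) * \<bar>\<psi> r\<bar>))" for r
      by (simp add: f_r[OF True] abs_mult)
    then have "(\<integral>r. norm (f s r) \<partial>lborel) = (LINT r:{0..s}|lborel. \<bar>u (t - s)\<bar> * ((s - r) powr (\<alpha> - 1) * \<bar>\<psi> r\<bar>))"
      unfolding set_lebesgue_integral_def by simp
    then show ?thesis using True eq by simp
  next
    case False then show ?thesis using f_r0[OF False] by simp
  qed
  have "integrable (lborel \<Otimes>\<^sub>M lborel) (\<lambda>(s, r). f s r)"
  proof (rule lborel_pair.Fubini_integrable[OF meas])
    show "integrable lborel (\<lambda>s. \<integral>r. norm (case (s, r) of (s, r) \<Rightarrow> f s r) \<partial>lborel)"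
      using borel_integrable_atLeastAtMost'[OF c2]
      unfolding prod.case norm_inner set_integrable_def .
    have "integrable lborel (f s)" for s
    proof (cases "s \<in> {0..t}")
      case True
      then have "f s = (\<lambda>r. indicator {0..s} r *\<^sub>R (u (t - s) * ((s - r) powr (\<alpha> - 1) * \<psi> r)))"
        using f_r by blast
      then show ?thesis using int_r[OF True \<psi>, of "u (t - s)"] by (simp only: set_integrable_def)
    next
      case False
      then have "f s = (\<lambda>r. 0)" using f_r0 by blast
      then show ?thesis by simp
    qed
    then show "AE s in lborel. integrable lborel (\<lambda>r. case (s, r) of (s, r) \<Rightarrow> f s r)" by simp
  qed
  from lborel_pair.Fubini_integral[OF this]
  have swap: "(\<integral>r. (\<integral>s. f s r \<partial>lborel) \<partial>lborel) = (\<integral>s. (\<integral>r. f s r \<partial>lborel) \<partial>lborel)" .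
  have outer: "(\<integral>s. f s r \<partial>lborel) = indicator {0..t} r *\<^sub>R (J u (t - r) * \<psi> r)" for r
  proof (cases "r \<in> {0..t}")
    case True
    have e: "f s r = indicator {0..t - r} (t - s) *\<^sub>R (\<psi> r * ((t - r - (t - s)) powr (\<alpha> - 1) * u (t - s)))" for s
      using f_s[OF True, of s] by (auto simp: indicator_def)
    have "(\<integral>s. f s r \<partial>lborel) = (LINT \<sigma>:{0..t - r}|lborel. \<psi> r * ((t - r - \<sigma>) powr (\<alpha> - 1) * u \<sigma>))"
      unfolding set_lebesgue_integral_def e
      using lborel_integral_real_affine[of "-1" "\<lambda>\<sigma>. indicator {0..t - r} \<sigma> *\<^sub>R (\<psi> r * ((t - r - \<sigma>) powr (\<alpha> - 1) * u \<sigma>))" t]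
      by simp
    also have "\<dots> = \<psi> r * J u (t - r)" using eq_r[of "t - r" u "\<psi> r"] True u by simp
    finally show ?thesis using True by simp
  next
    case False then show ?thesis using f_s0[OF False] by simp
  qed
  have cu: "continuous_on {0..t} (\<lambda>r. J u (t - r) * \<psi> r)"
    by (intro continuous_intros \<psi> continuous_on_compose2[OF abel_integral_continuous[OF u]]) auto
  have "integral {0..t} (\<lambda>s. u (t - s) * J \<psi> s) = (LINT s:{0..t}|lborel. u (t - s) * J \<psi> s)"
    by (rule set_borel_integral_eq_integral(2)[symmetric, OF borel_integrable_atLeastAtMost'[OF c1]])
  also have "\<dots> = (LINT r:{0..t}|lborel. J u (t - r) * \<psi> r)"
    using swap by (simp add: inner outer set_lebesgue_integral_def)
  also have "\<dots> = integral {0..t} (\<lambda>r. J u (t - r) * \<psi> r)"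
    by (rule set_borel_integral_eq_integral(2)[OF borel_integrable_atLeastAtMost'[OF cu]])
  finally show ?thesis .
qed

end

section \<open>Abel integral equations with Lipschitz right-hand side\<close>

definition abel_solution :: "real \<Rightarrow> (real \<Rightarrow> real) \<Rightarrow> real \<Rightarrow> (real \<Rightarrow> real) \<Rightarrow> bool" where
  "abel_solution \<alpha> G \<eta> x \<longleftrightarrow> continuous_on {0..} x \<and>
     (\<forall>t\<ge>0. x t = \<eta> + abel_integral \<alpha> (\<lambda>s. G (x s)) t)"

lemma abel_solution_continuous: "abel_solution \<alpha> G \<eta> x \<Longrightarrow> continuous_on {0..t} x"
  unfolding abel_solution_def by (auto elim: continuous_on_subset)

lemma abel_solution_eq:
  "abel_solution \<alpha> G \<eta> x \<Longrightarrow> 0 \<le> t \<Longrightarrow> x t = \<eta> + abel_integral \<alpha> (\<lambda>s. G (x s)) t"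
  unfolding abel_solution_def by blast

context fractional_order begin

lemma abel_solution_0: "abel_solution \<alpha> G \<eta> x \<Longrightarrow> x 0 = \<eta>"
  using abel_solution_eq[of \<alpha> G \<eta> x 0] by simp

text \<open>
  In the norm \<open>sup exp(- \<mu> t) |v t|\<close> the operator \<open>L J\<close> then has norm at most 1/2 for \<open>L \<ge> 0\<close>.  The summand 1 covers
  \<open>L = 0\<close>.
\<close>

definition halving_rate :: "real \<Rightarrow> real \<Rightarrow> bool" where
  "halving_rate L \<mu> \<longleftrightarrow> 0 < \<mu> \<and>
     (\<forall>t\<ge>0. J (\<lambda>s. exp (\<mu> * s)) t \<le> 1 / (2 * (L + 1)) * exp (\<mu> * t))"

text \<open>
  The last stretch of length \<open>\<delta>\<close> contributes at most \<open>\<delta>\<^sup>\<alpha>/\<alpha>\<close> times the maximum of the exponential; before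
  it the kernel is at most \<open>\<delta>\<^sup>\<alpha>\<^sup>-\<^sup>1\<close> and the integral of \<open>exp(\<mu> s)\<close> gains a factor \<open>1/\<mu>\<close>.
\<close>

lemma halving_rate_exists:
  assumes "0 \<le> L"
  shows "\<exists>\<mu>. halving_rate L \<mu>"
proof -
  define \<epsilon> where "\<epsilon> = 1 / (2 * (L + 1))"
  have \<epsilon>: "0 < \<epsilon>" using assms by (simp add: \<epsilon>_def)
  define \<delta> where "\<delta> = (\<epsilon> * \<alpha> / 2) powr (1 / \<alpha>)"
  have \<delta>: "0 < \<delta>" "\<delta> powr \<alpha> / \<alpha> = \<epsilon> / 2"
    using \<epsilon> order_pos by (auto simp: \<delta>_def powr_powr)
  define \<mu> where "\<mu> = 2 * \<delta> powr (\<alpha> - 1) / \<epsilon>"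
  have \<mu>: "0 < \<mu>" using \<epsilon> \<delta> by (simp add: \<mu>_def)
  have "J (\<lambda>s. exp (\<mu> * s)) t \<le> \<epsilon> * exp (\<mu> * t)" if t: "0 \<le> t" for t
  proof -
    define r where "r = max 0 (t - \<delta>)"
    have r: "0 \<le> r" "r \<le> t" "t - r \<le> \<delta>" "r = 0 \<or> t - r = \<delta>" using t \<delta> by (auto simp: r_def)
    have cont: "continuous_on {a..b} (\<lambda>s. exp (\<mu> * s))" for a b by (intro continuous_intros)
    have h: "((\<lambda>s. \<delta> powr (\<alpha> - 1) * exp (\<mu> * s)) has_integral
        \<delta> powr (\<alpha> - 1) * (exp (\<mu> * r) / \<mu> - exp (\<mu> * 0) / \<mu>)) {0..r}"
      using r \<mu> by (intro has_integral_mult_right fundamental_theorem_of_calculus)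
        (auto intro!: derivative_eq_intros simp flip: has_real_derivative_iff_has_vector_derivative)
    have "integral {0..r} (\<lambda>s. (t - s) powr (\<alpha> - 1) * exp (\<mu> * s))
        \<le> integral {0..r} (\<lambda>s. \<delta> powr (\<alpha> - 1) * exp (\<mu> * s))"
    proof (cases "r = 0")
      case False
      then have "t - r = \<delta>" using r by auto
      then show ?thesis using h \<delta> r cont
        by (intro integral_le kernel_mult_integrable) (auto intro!: mult_right_mono kernel_antimono)
    qed simp
    also have "\<dots> = \<delta> powr (\<alpha> - 1) * (exp (\<mu> * r) / \<mu> - exp (\<mu> * 0) / \<mu>)" using h by (rule integral_unique)
    also have "\<dots> \<le> \<delta> powr (\<alpha> - 1) * (exp (\<mu> * r) / \<mu>)" using \<mu> by (intro mult_left_mono) auto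
    also have "\<dots> = \<epsilon> / 2 * exp (\<mu> * r)" using \<epsilon> \<delta> by (simp add: \<mu>_def field_simps)
    also have "\<dots> \<le> \<epsilon> / 2 * exp (\<mu> * t)" using \<epsilon> \<mu> r by (intro mult_left_mono) auto
    finally have 1: "integral {0..r} (\<lambda>s. (t - s) powr (\<alpha> - 1) * exp (\<mu> * s)) \<le> \<epsilon> / 2 * exp (\<mu> * t)" .
    have "integral {r..t} (\<lambda>s. (t - s) powr (\<alpha> - 1) * exp (\<mu> * s))
        \<le> exp (\<mu> * t) * ((t - r) powr \<alpha> - (t - t) powr \<alpha>) / \<alpha>"
      using r \<mu> by (intro kernel_integral_le cont) auto
    also have "\<dots> \<le> exp (\<mu> * t) * (\<delta> powr \<alpha>) / \<alpha>"
      using r order_pos by (intro divide_right_mono mult_left_mono) (auto intro: powr_mono2)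
    also have "\<dots> = exp (\<mu> * t) * (\<delta> powr \<alpha> / \<alpha>)" by simp
    also have "\<dots> = \<epsilon> / 2 * exp (\<mu> * t)" unfolding \<delta>(2) by simp
    finally show ?thesis using 1 abel_integral_split[OF cont r(1,2)] by simp
  qed
  then show ?thesis using \<mu> unfolding halving_rate_def \<epsilon>_def by blast
qed

text \<open>
  At a maximum \<open>M\<close> of \<open>exp(- \<mu> t) |v t|\<close> the hypothesis reads \<open>M exp(\<mu> t) \<le> c + M exp(\<mu> t) / 2\<close>.
\<close>

lemma singular_gronwall:
  assumes L: "0 \<le> L" and rate: "halving_rate L \<mu>"
    and T: "0 \<le> T" and v: "continuous_on {0..T} v"
    and bound: "\<And>t. 0 \<le> t \<Longrightarrow> t \<le> T \<Longrightarrow> \<bar>v t\<bar> \<le> c + L * J (\<lambda>s. \<bar>v s\<bar>) t"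
  shows "\<bar>v T\<bar> \<le> 2 * c * exp (\<mu> * T)"
proof -
  have \<mu>: "0 < \<mu>"
    and J: "\<And>t. 0 \<le> t \<Longrightarrow> J (\<lambda>s. exp (\<mu> * s)) t \<le> 1 / (2 * (L + 1)) * exp (\<mu> * t)"
    using rate by (auto simp: halving_rate_def)
  have "continuous_on {0..T} (\<lambda>t. exp (- \<mu> * t) * \<bar>v t\<bar>)" by (intro continuous_intros v)
  then obtain t where t: "0 \<le> t" "t \<le> T"
    and max: "\<And>s. 0 \<le> s \<Longrightarrow> s \<le> T \<Longrightarrow> exp (- \<mu> * s) * \<bar>v s\<bar> \<le> exp (- \<mu> * t) * \<bar>v t\<bar>"
    using continuous_attains_sup[of "{0..T}" "\<lambda>t. exp (- \<mu> * t) * \<bar>v t\<bar>"] T by auto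
  define M where "M = exp (- \<mu> * t) * \<bar>v t\<bar>"
  have M0: "0 \<le> M" by (simp add: M_def)
  have vs: "\<bar>v s\<bar> \<le> M * exp (\<mu> * s)" if "0 \<le> s" "s \<le> T" for s
    using max[OF that] unfolding M_def[symmetric] by (simp add: exp_minus field_simps)
  have vt: "\<bar>v t\<bar> = M * exp (\<mu> * t)" by (simp add: M_def exp_minus field_simps)
  have "J (\<lambda>s. \<bar>v s\<bar>) t \<le> J (\<lambda>s. M * exp (\<mu> * s)) t"
    using t vs by (intro abel_integral_mono continuous_intros continuous_on_subset[OF v]) auto
  also have "\<dots> = M * J (\<lambda>s. exp (\<mu> * s)) t" by (rule abel_integral_cmult)
  also have "\<dots> \<le> M * (1 / (2 * (L + 1)) * exp (\<mu> * t))" using J[OF t(1)] M0 by (rule mult_left_mono)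
  finally have "L * J (\<lambda>s. \<bar>v s\<bar>) t \<le> L * (M * (1 / (2 * (L + 1)) * exp (\<mu> * t)))"
    using L by (rule mult_left_mono)
  also have "\<dots> = L / (L + 1) * (M * exp (\<mu> * t) / 2)" using L by (simp add: field_simps)
  also have "\<dots> \<le> 1 * (M * exp (\<mu> * t) / 2)" using L M0 by (intro mult_right_mono) auto
  finally have "M * exp (\<mu> * t) \<le> c + M * exp (\<mu> * t) / 2" using bound[OF t] vt by simp
  then have "M * exp (\<mu> * t) \<le> 2 * c" by simp
  moreover have "M \<le> M * exp (\<mu> * t)" using M0 \<mu> t by (simp add: mult_le_cancel_left1)
  ultimately have "M \<le> 2 * c" by simp
  have "\<bar>v T\<bar> \<le> M * exp (\<mu> * T)" using vs T by simp
  also have "\<dots> \<le> 2 * c * exp (\<mu> * T)" using \<open>M \<le> 2 * c\<close> by (intro mult_right_mono) auto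
  finally show ?thesis .
qed

lemma abel_solution_stability:
  assumes rate: "halving_rate L \<mu>" and T: "0 \<le> T" and lip: "L-lipschitz_on S G"
    and x: "abel_solution \<alpha> G \<eta> x" and x': "abel_solution \<alpha> G \<eta>' x'"
    and S: "x ` {0..T} \<subseteq> S" "x' ` {0..T} \<subseteq> S"
  shows "\<bar>x T - x' T\<bar> \<le> 2 * \<bar>\<eta> - \<eta>'\<bar> * exp (\<mu> * T)"
proof (rule singular_gronwall[OF lipschitz_on_nonneg[OF lip] rate T])
  have G: "continuous_on S G" using lip by (rule lipschitz_on_continuous_on)
  show "continuous_on {0..T} (\<lambda>t. x t - x' t)"
    by (intro continuous_intros abel_solution_continuous[OF x] abel_solution_continuous[OF x'])
  fix t assume t: "0 \<le> t" "t \<le> T"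
  have S': "x ` {0..t} \<subseteq> S" "x' ` {0..t} \<subseteq> S" using S t by auto
  have c: "continuous_on {0..t} (\<lambda>s. G (x s))" "continuous_on {0..t} (\<lambda>s. G (x' s))"
    by (rule continuous_on_compose2[OF G abel_solution_continuous[OF x] S'(1)],
        rule continuous_on_compose2[OF G abel_solution_continuous[OF x'] S'(2)])
  have "\<bar>J (\<lambda>s. G (x s) - G (x' s)) t\<bar> \<le> J (\<lambda>s. \<bar>G (x s) - G (x' s)\<bar>) t"
    by (intro abel_integral_abs_le continuous_intros c)
  also have "\<dots> \<le> J (\<lambda>s. L * \<bar>x s - x' s\<bar>) t"
  proof (intro abel_integral_mono)
    show "\<bar>G (x s) - G (x' s)\<bar> \<le> L * \<bar>x s - x' s\<bar>" if "0 \<le> s" "s \<le> t" for s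
      using lipschitz_onD[OF lip, of "x s" "x' s"] S' that by (auto simp: dist_real_def image_subset_iff)
  qed (intro continuous_intros c abel_solution_continuous[OF x] abel_solution_continuous[OF x'])+
  also have "\<dots> = L * J (\<lambda>s. \<bar>x s - x' s\<bar>) t" by (rule abel_integral_cmult)
  finally show "\<bar>x t - x' t\<bar> \<le> \<bar>\<eta> - \<eta>'\<bar> + L * J (\<lambda>s. \<bar>x s - x' s\<bar>) t"
    using abel_solution_eq[OF x t(1)] abel_solution_eq[OF x' t(1)] abel_integral_diff[OF c] by linarith
qed

text \<open>
  Picard iteration, with convergence measured by the weight \<open>exp(\<mu> t)\<close> so that no restriction to short
  times is needed.
\<close>

lemma abel_solution_exists_lipschitz:
  assumes lip: "L-lipschitz_on UNIV G"
  shows "\<exists>x. abel_solution \<alpha> G \<eta> x"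
proof -
  have L: "0 \<le> L" using lip by (rule lipschitz_on_nonneg)
  have Gc: "continuous_on UNIV G" using lip by (rule lipschitz_on_continuous_on)
  have Gxc: "continuous_on A (\<lambda>s. G (y s))" if "continuous_on A y" for A :: "real set" and y
    by (rule continuous_on_compose2[OF Gc that]) auto
  obtain \<mu> where "halving_rate L \<mu>" using halving_rate_exists[OF L] by blast
  then have \<mu>: "0 < \<mu>"
    and Jexp: "\<And>t. 0 \<le> t \<Longrightarrow> J (\<lambda>s. exp (\<mu> * s)) t \<le> 1 / (2 * (L + 1)) * exp (\<mu> * t)"
    by (auto simp: halving_rate_def)
  \<comment> \<open>The Picard operator halves distances in the norm weighted by \<open>exp (\<mu> t)\<close>.\<close>
  have contract: "\<bar>J (\<lambda>s. G (y s)) t - J (\<lambda>s. G (z s)) t\<bar> \<le> C / 2 * exp (\<mu> * t)"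
    if t: "0 \<le> t" and y: "continuous_on {0..t} y" and z: "continuous_on {0..t} z" and C: "0 \<le> C"
      and yz: "\<And>s. 0 \<le> s \<Longrightarrow> s \<le> t \<Longrightarrow> \<bar>y s - z s\<bar> \<le> C * exp (\<mu> * s)" for y z t C
  proof -
    have "\<bar>J (\<lambda>s. G (y s)) t - J (\<lambda>s. G (z s)) t\<bar> = \<bar>J (\<lambda>s. G (y s) - G (z s)) t\<bar>"
      by (simp add: abel_integral_diff Gxc y z)
    also have "\<dots> \<le> J (\<lambda>s. \<bar>G (y s) - G (z s)\<bar>) t"
      by (intro abel_integral_abs_le continuous_intros Gxc y z)
    also have "\<dots> \<le> J (\<lambda>s. (L * C) * exp (\<mu> * s)) t"
    proof (intro abel_integral_mono)
      fix s assume s: "0 \<le> s" "s \<le> t"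
      have "\<bar>G (y s) - G (z s)\<bar> \<le> L * \<bar>y s - z s\<bar>"
        using lipschitz_onD[OF lip, of "y s" "z s"] by (auto simp: dist_real_def)
      also have "\<dots> \<le> L * (C * exp (\<mu> * s))" using yz[OF s] L by (rule mult_left_mono)
      finally show "\<bar>G (y s) - G (z s)\<bar> \<le> L * C * exp (\<mu> * s)" by simp
    qed (intro continuous_intros Gxc y z)+
    also have "\<dots> = L * C * J (\<lambda>s. exp (\<mu> * s)) t" by (rule abel_integral_cmult)
    also have "\<dots> \<le> L * C * (1 / (2 * (L + 1)) * exp (\<mu> * t))"
      using Jexp[OF t] L C by (intro mult_left_mono) auto
    also have "\<dots> = L / (L + 1) * (C / 2 * exp (\<mu> * t))" using L by (simp add: field_simps)
    also have "\<dots> \<le> 1 * (C / 2 * exp (\<mu> * t))" using L C by (intro mult_right_mono) auto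
    finally show ?thesis by simp
  qed
  define X where "X = rec_nat (\<lambda>t. \<eta>) (\<lambda>n y t. \<eta> + J (\<lambda>s. G (y s)) t)"
  have X0: "X 0 = (\<lambda>t. \<eta>)" and XS: "\<And>n t. X (Suc n) t = \<eta> + J (\<lambda>s. G (X n s)) t"
    by (simp_all add: X_def)
  have Xc: "continuous_on {0..T} (X n)" for n T
  proof (induction n)
    case (Suc n)
    then show ?case using abel_integral_continuous[OF Gxc[OF Suc]]
      by (auto simp: XS[abs_def] intro!: continuous_intros)
  qed (simp add: X0)
  define C where "C = \<bar>G \<eta>\<bar> * (1 / (2 * (L + 1)))"
  have C: "0 \<le> C" using L by (simp add: C_def)
  have step: "\<bar>X (Suc n) t - X n t\<bar> \<le> C / 2 ^ n * exp (\<mu> * t)" if "0 \<le> t" for n t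
    using that
  proof (induction n arbitrary: t)
    case 0
    have "\<bar>X (Suc 0) t - X 0 t\<bar> \<le> J (\<lambda>s. \<bar>G \<eta>\<bar>) t"
      using abel_integral_abs_le[of t "\<lambda>s. G \<eta>"] by (simp add: XS X0)
    also have "\<dots> \<le> J (\<lambda>s. \<bar>G \<eta>\<bar> * exp (\<mu> * s)) t"
      using \<mu> by (intro abel_integral_mono continuous_intros) (auto simp: mult_le_cancel_left1)
    also have "\<dots> = \<bar>G \<eta>\<bar> * J (\<lambda>s. exp (\<mu> * s)) t" by (rule abel_integral_cmult)
    also have "\<dots> \<le> \<bar>G \<eta>\<bar> * (1 / (2 * (L + 1)) * exp (\<mu> * t))"
      using Jexp[OF 0] by (intro mult_left_mono) auto
    finally show ?case by (simp add: C_def)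
  next
    case (Suc n)
    have "\<bar>J (\<lambda>s. G (X (Suc n) s)) t - J (\<lambda>s. G (X n s)) t\<bar> \<le> (C / 2 ^ n) / 2 * exp (\<mu> * t)"
      using Suc C by (intro contract Xc) auto
    then show ?case by (simp add: XS[of "Suc n"] XS[of n] field_simps)
  qed
  have tele: "\<bar>X (n + m) t - X n t\<bar> \<le> C * (2 / 2 ^ n - 2 / 2 ^ (n + m)) * exp (\<mu> * t)" if "0 \<le> t" for n m t
  proof (induction m)
    case (Suc m)
    have "\<bar>X (n + Suc m) t - X n t\<bar> \<le> \<bar>X (n + m) t - X n t\<bar> + \<bar>X (Suc (n + m)) t - X (n + m) t\<bar>" by simp
    also have "\<dots> \<le> C * (2 / 2 ^ n - 2 / 2 ^ (n + m)) * exp (\<mu> * t) + C / 2 ^ (n + m) * exp (\<mu> * t)"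
      by (intro add_mono Suc step that)
    also have "\<dots> = C * (2 / 2 ^ n - 2 / 2 ^ (n + Suc m)) * exp (\<mu> * t)"
      by (simp add: field_simps)
    finally show ?case .
  qed simp
  have tail: "\<bar>X k t - X n t\<bar> \<le> 2 * C / 2 ^ n * exp (\<mu> * t)" if "0 \<le> t" "n \<le> k" for n k t
  proof -
    have "\<bar>X k t - X n t\<bar> \<le> C * (2 / 2 ^ n - 2 / 2 ^ k) * exp (\<mu> * t)"
      using tele[OF that(1), of n "k - n"] that by simp
    also have "\<dots> \<le> C * (2 / 2 ^ n) * exp (\<mu> * t)" using C by (intro mult_right_mono mult_left_mono) auto
    finally show ?thesis by (simp add: mult.commute)
  qed
  have geo: "(\<lambda>n. K / 2 ^ n) \<longlonglongrightarrow> 0" for K :: real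
    using tendsto_mult_right[OF LIMSEQ_realpow_zero[of "1/2::real"], of K]
    by (simp add: power_divide)
  define x where "x t = lim (\<lambda>n. X n t)" for t
  have lim: "(\<lambda>n. X n t) \<longlonglongrightarrow> x t" if t: "0 \<le> t" for t
  proof -
    have "Cauchy (\<lambda>n. X n t)"
    proof (rule metric_CauchyI)
      fix e :: real assume "0 < e"
      then have "\<forall>\<^sub>F n in sequentially. 4 * C * exp (\<mu> * t) / 2 ^ n < e"
        by (rule order_tendstoD(2)[OF geo])
      then obtain N where N: "4 * C * exp (\<mu> * t) / 2 ^ N < e"
        by (auto simp: eventually_sequentially)
      have "dist (X m t) (X n t) < e" if "N \<le> m" "N \<le> n" for m n
        using tail[OF t that(1)] tail[OF t that(2)] N by (simp add: dist_real_def)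
      then show "\<exists>M. \<forall>m\<ge>M. \<forall>n\<ge>M. dist (X m t) (X n t) < e" by blast
    qed
    then show ?thesis by (simp add: x_def Cauchy_convergent_iff convergent_LIMSEQ_iff)
  qed
  have err: "\<bar>x t - X n t\<bar> \<le> 2 * C / 2 ^ n * exp (\<mu> * t)" if t: "0 \<le> t" for n t
  proof (rule tendsto_upperbound)
    show "(\<lambda>k. \<bar>X k t - X n t\<bar>) \<longlonglongrightarrow> \<bar>x t - X n t\<bar>" by (intro tendsto_intros lim t)
    show "\<forall>\<^sub>F k in sequentially. \<bar>X k t - X n t\<bar> \<le> 2 * C / 2 ^ n * exp (\<mu> * t)"
      using tail[OF t] by (auto simp: eventually_sequentially)
  qed simp
  have xc: "continuous_on {0..T} x" for T
  proof (rule uniform_limit_theorem[of _ X])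
    show "\<forall>\<^sub>F n in sequentially. continuous_on {0..T} (X n)" using Xc by simp
    show "uniform_limit {0..T} X x sequentially"
    proof (rule uniform_limitI)
      fix e :: real assume "0 < e"
      then have "\<forall>\<^sub>F n in sequentially. 2 * C * exp (\<mu> * T) / 2 ^ n < e"
        by (rule order_tendstoD(2)[OF geo])
      then show "\<forall>\<^sub>F n in sequentially. \<forall>t\<in>{0..T}. dist (X n t) (x t) < e"
      proof eventually_elim
        case (elim n)
        show ?case
        proof
          fix t assume t: "t \<in> {0..T}"
          have "\<bar>x t - X n t\<bar> \<le> 2 * C / 2 ^ n * exp (\<mu> * t)" using err t by simp
          also have "\<dots> \<le> 2 * C / 2 ^ n * exp (\<mu> * T)" using C t \<mu> by (intro mult_left_mono) auto
          also have "\<dots> < e" using elim by simp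
          finally show "dist (X n t) (x t) < e" by (simp add: dist_real_def abs_minus_commute)
        qed
      qed
    qed
  qed simp
  have "x t = \<eta> + J (\<lambda>s. G (x s)) t" if t: "0 \<le> t" for t
  proof (rule LIMSEQ_unique[OF LIMSEQ_Suc[OF lim[OF t]]])
    have "(\<lambda>n. (C * exp (\<mu> * t)) / 2 ^ n) \<longlonglongrightarrow> 0" by (rule geo)
    then have "(\<lambda>n. X (Suc n) t - (\<eta> + J (\<lambda>s. G (x s)) t)) \<longlonglongrightarrow> 0"
    proof (rule Lim_null_comparison[rotated], intro always_eventually allI)
      fix n
      have "\<bar>J (\<lambda>s. G (X n s)) t - J (\<lambda>s. G (x s)) t\<bar> \<le> (2 * C / 2 ^ n) / 2 * exp (\<mu> * t)"
        using t C err by (intro contract Xc xc) (auto simp: abs_minus_commute)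
      then show "norm (X (Suc n) t - (\<eta> + J (\<lambda>s. G (x s)) t)) \<le> C * exp (\<mu> * t) / 2 ^ n"
        by (simp add: XS)
    qed
    then show "(\<lambda>n. X (Suc n) t) \<longlonglongrightarrow> \<eta> + J (\<lambda>s. G (x s)) t" by (simp add: LIM_zero_iff)
  qed
  moreover have "continuous_on {0..} x"
    unfolding continuous_on_eq_continuous_within
  proof
    fix t :: real assume t: "t \<in> {0..}"
    have "continuous (at t within {0..t + 1}) x"
      using xc[of "t + 1"] t by (auto simp: continuous_on_eq_continuous_within)
    moreover have "at t within {0..t + 1} = at t within {0..}"
      by (rule at_within_nhd[of _ "{..<t + 1}"]) auto
    ultimately show "continuous (at t within {0..}) x" by simp
  qed
  ultimately show ?thesis unfolding abel_solution_def by blast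
qed

end

section \<open>The relaxation function and comparison\<close>

text \<open>
  Kernels \<open>(t - s) powr (\<alpha> - 1)\<close> vanish at \<open>s = t\<close>, so upper bounds by them hold only for \<open>s < t\<close>.
\<close>

lemma integral_le_open_right:
  fixes f g :: "real \<Rightarrow> real"
  assumes "f integrable_on {a..b}" "g integrable_on {a..b}" "\<And>s. a \<le> s \<Longrightarrow> s < b \<Longrightarrow> f s \<le> g s"
  shows "integral {a..b} f \<le> integral {a..b} g"
proof -
  let ?g = "\<lambda>s. if s = b then f s else g s"
  have "?g integrable_on {a..b}"
    by (rule integrable_spike_finite[of "{b}", OF _ _ assms(2)]) auto
  then have "integral {a..b} f \<le> integral {a..b} ?g"
    using assms by (intro integral_le) auto
  also have "integral {a..b} ?g = integral {a..b} g"
    by (rule integral_spike[of "{b}"]) auto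
  finally show ?thesis .
qed

lemma first_zero:
  fixes d :: "real \<Rightarrow> real"
  assumes cont: "continuous_on {0..} d" and "0 < d 0" "0 \<le> T" "d T \<le> 0"
  obtains t where "0 < t" "t \<le> T" "d t = 0" "\<And>s. 0 \<le> s \<Longrightarrow> s < t \<Longrightarrow> 0 < d s"
proof -
  have c: "continuous_on {0..t} d" for t using cont by (rule continuous_on_subset) auto
  have "\<exists>s. 0 \<le> s \<and> s \<le> T \<and> d s = 0"
    using IVT2'[of d T 0 0] assms c[of T] by auto
  moreover have "closed ({0..T} \<inter> d -` {0})"
    by (intro continuous_closed_preimage c) auto
  then have "compact ({0..T} \<inter> d -` {0})"
    using compact_Int_closed[of "{0..T}" "{0..T} \<inter> d -` {0}"] by (simp add: Int_assoc[symmetric])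
  ultimately obtain t where t: "0 \<le> t" "t \<le> T" "d t = 0"
    and min: "\<And>s. 0 \<le> s \<Longrightarrow> s \<le> T \<Longrightarrow> d s = 0 \<Longrightarrow> t \<le> s"
    using compact_attains_inf[of "{0..T} \<inter> d -` {0}"] by fastforce
  have "0 < d s" if s: "0 \<le> s" "s < t" for s
  proof (rule ccontr)
    assume "\<not> 0 < d s"
    then obtain r where "0 \<le> r" "r \<le> s" "d r = 0"
      using IVT2'[of d s 0 0] assms s c[of s] by auto
    then show False using min[of r] s t by auto
  qed
  moreover have "0 < t" using t assms by (cases "t = 0") auto
  ultimately show ?thesis using that t by blast
qed

context fractional_order begin

lemma kernel_ratio_le:
  assumes "0 \<le> x" "0 < c" "0 < d" "x \<le> c / d"
  shows "x powr (1 - \<alpha>) * c powr (\<alpha> - 1) \<le> d powr (\<alpha> - 1)"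
proof -
  have "x powr (1 - \<alpha>) * c powr (\<alpha> - 1) \<le> (c / d) powr (1 - \<alpha>) * c powr (\<alpha> - 1)"
    using assms order_less_1 by (intro mult_right_mono powr_mono2) auto
  also have "\<dots> = d powr (\<alpha> - 1)"
    using assms by (simp add: powr_divide powr_diff field_simps)
  finally show ?thesis .
qed

lemma kernel_ratio_ge:
  assumes "0 < c" "0 < d" "c / d \<le> x"
  shows "d powr (\<alpha> - 1) \<le> x powr (1 - \<alpha>) * c powr (\<alpha> - 1)"
proof -
  have "d powr (\<alpha> - 1) = (c / d) powr (1 - \<alpha>) * c powr (\<alpha> - 1)"
    using assms by (simp add: powr_divide powr_diff field_simps)
  also have "\<dots> \<le> x powr (1 - \<alpha>) * c powr (\<alpha> - 1)"
    using assms order_less_1 by (intro mult_right_mono powr_mono2) auto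
  finally show ?thesis .
qed

text \<open>
  Here \<open>d\<close> solves \<open>d = F - l J d\<close> with a source \<open>F\<close> that decays no faster than the kernel.  Suppose \<open>t'\<close> is the
  first zero of \<open>d\<close> and \<open>t < t'\<close> is close to it.  Passing from \<open>t\<close> to \<open>t'\<close> multiplies the kernel at each
  \<open>s < t\<close> by at most \<open>(t/t')\<^sup>1\<^sup>-\<^sup>\<alpha>\<close>, by log-convexity, while the source keeps at least that fraction.  So
  the positive excess \<open>d t\<close> of the source over the memory can only be used up by the memory of \<open>[t, t']\<close>,
  which is at most \<open>l (t' - t)\<^sup>\<alpha>/\<alpha>\<close> times the maximum of \<open>d\<close> there.  That is too little when \<open>t\<close> is chosen
  to attain this maximum.
\<close>

lemma positive_if_source_decays_slower:
  assumes l: "0 < l" and cont: "continuous_on {0..} d" and d0: "0 < d 0"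
    and source: "\<And>t t'. 0 < t \<Longrightarrow> t < t' \<Longrightarrow>
      (t / t') powr (1 - \<alpha>) * (d t + l * J d t) \<le> d t' + l * J d t'"
    and T: "0 \<le> T"
  shows "0 < d T"
proof (rule ccontr)
  assume "\<not> 0 < d T"
  then obtain t' where t': "0 < t'" "d t' = 0" and pos: "\<And>s. 0 \<le> s \<Longrightarrow> s < t' \<Longrightarrow> 0 < d s"
    using first_zero[OF cont d0 T] by (metis not_less)
  \<comment> \<open>The width makes \<open>l \<delta>\<^sup>\<alpha>/\<alpha> \<le> 1/4\<close>, below the lower bound 1/2 for the ratio \<open>r\<close>.\<close>
  define \<delta> where "\<delta> = min (t' / 2) ((\<alpha> / (4 * l)) powr (1 / \<alpha>))"
  have \<delta>: "0 < \<delta>" "\<delta> \<le> t' / 2" using t' order_pos l by (auto simp: \<delta>_def)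
  have "\<delta> powr \<alpha> \<le> ((\<alpha> / (4 * l)) powr (1 / \<alpha>)) powr \<alpha>"
    using \<delta> order_pos by (intro powr_mono2) (auto simp: \<delta>_def)
  also have "\<dots> = \<alpha> / (4 * l)" using order_pos l by (simp add: powr_powr)
  finally have l\<delta>: "l * \<delta> powr \<alpha> / \<alpha> \<le> 1 / 4" using order_pos l by (simp add: field_simps)
  have c: "continuous_on {a..b} d" if "0 \<le> a" for a b
    using cont by (rule continuous_on_subset) (use that in auto)
  obtain t where t: "t' - \<delta> \<le> t" "t \<le> t'" and max: "\<And>s. t' - \<delta> \<le> s \<Longrightarrow> s \<le> t' \<Longrightarrow> d s \<le> d t"
    using continuous_attains_sup[of "{t' - \<delta>..t'}" d] c[of "t' - \<delta>" t'] \<delta> by auto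
  have dt: "0 < d t" using max[of "t' - \<delta>"] pos[of "t' - \<delta>"] \<delta> by auto
  then have tt: "t < t'" using t t' by (cases "t = t'") auto
  have t0: "0 < t" using t \<delta> t' by auto
  define r where "r = (t / t') powr (1 - \<alpha>)"
  have "1 / 2 = (1 / 2 :: real) powr 1" by simp
  also have "\<dots> \<le> (1 / 2) powr (1 - \<alpha>)" using order_pos by (intro powr_mono') auto
  also have "\<dots> \<le> r" unfolding r_def
    using t \<delta> t' order_less_1 by (intro powr_mono2) (auto simp: field_simps)
  finally have r: "1 / 2 \<le> r" .
  have "integral {0..t} (\<lambda>s. (t' - s) powr (\<alpha> - 1) * d s)
      \<le> integral {0..t} (\<lambda>s. r * ((t - s) powr (\<alpha> - 1) * d s))"
  proof (rule integral_le_open_right)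
    show "(\<lambda>s. r * ((t - s) powr (\<alpha> - 1) * d s)) integrable_on {0..t}"
      by (intro integrable_on_mult_right kernel_mult_integrable c) auto
    fix s assume s: "0 \<le> s" "s < t"
    have "(t - s) / (t' - s) \<le> t / t'" using s tt t0 by (simp add: field_simps mult_left_mono)
    then have "(t' - s) powr (\<alpha> - 1) \<le> r * (t - s) powr (\<alpha> - 1)"
      unfolding r_def using s tt by (intro kernel_ratio_ge) auto
    then show "(t' - s) powr (\<alpha> - 1) * d s \<le> r * ((t - s) powr (\<alpha> - 1) * d s)"
      using pos[of s] s tt by (simp add: mult.assoc[symmetric] mult_right_mono)
  qed (use tt c[of 0 t] in \<open>auto intro!: kernel_mult_integrable\<close>)
  also have "\<dots> = r * J d t" by (simp add: abel_integral_def)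
  finally have 1: "integral {0..t} (\<lambda>s. (t' - s) powr (\<alpha> - 1) * d s) \<le> r * J d t" .
  have "integral {t..t'} (\<lambda>s. (t' - s) powr (\<alpha> - 1) * d s)
      \<le> d t * ((t' - t) powr \<alpha> - (t' - t') powr \<alpha>) / \<alpha>"
    using tt t0 t max by (intro kernel_integral_le c) auto
  also have "\<dots> \<le> d t * (\<delta> powr \<alpha>) / \<alpha>"
    using t tt dt order_pos by (intro divide_right_mono mult_left_mono) (auto intro!: powr_mono2)
  finally have 2: "integral {t..t'} (\<lambda>s. (t' - s) powr (\<alpha> - 1) * d s) \<le> d t * \<delta> powr \<alpha> / \<alpha>" .
  have "r * (d t + l * J d t) \<le> l * J d t'"
    using source[OF t0 tt] t' by (simp add: r_def)
  also have "\<dots> \<le> l * (r * J d t + d t * \<delta> powr \<alpha> / \<alpha>)"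
    using 1 2 l abel_integral_split[OF c[of 0 t'], of t] t0 tt by (intro mult_left_mono) auto
  also have "\<dots> = r * (l * J d t) + d t * (l * \<delta> powr \<alpha> / \<alpha>)" by (simp add: algebra_simps)
  also have "\<dots> \<le> r * (l * J d t) + d t * (1 / 4)"
    using l\<delta> dt by (intro add_left_mono mult_left_mono) auto
  finally have "r * d t \<le> d t * (1 / 4)" by (simp add: algebra_simps)
  then have "r \<le> 1 / 4" using dt by simp
  with r show False by simp
qed

text \<open>
  The Mittag-Leffler function \<open>E\<^sub>\<alpha>(- l \<Gamma>(\<alpha>) t\<^sup>\<alpha>)\<close>, given by the equation that it solves.
\<close>

definition relaxation :: "real \<Rightarrow> real \<Rightarrow> real" where
  "relaxation l = (SOME u. abel_solution \<alpha> (\<lambda>y. - l * y) 1 u)"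

lemma relaxation_solution: "abel_solution \<alpha> (\<lambda>y. - l * y) 1 (relaxation l)"
proof -
  have "\<bar>l\<bar>-lipschitz_on UNIV (\<lambda>y. - l * y)"
    by (rule lipschitz_onI) (auto simp: dist_real_def abs_mult[symmetric] algebra_simps abs_minus_commute)
  then show ?thesis unfolding relaxation_def
    using abel_solution_exists_lipschitz by (metis (mono_tags, lifting) someI_ex)
qed

lemma relaxation_continuous: "continuous_on {0..} (relaxation l)"
  using relaxation_solution[of l] by (simp add: abel_solution_def)

lemma relaxation_eq: "0 \<le> t \<Longrightarrow> relaxation l t = 1 - l * J (relaxation l) t"
  using abel_solution_eq[OF relaxation_solution[of l]] abel_integral_cmult[of "- l" "relaxation l" t] by simp

lemma relaxation_0 [simp]: "relaxation l 0 = 1"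
  by (rule abel_solution_0[OF relaxation_solution])

lemma relaxation_pos:
  assumes l: "0 < l" and t: "0 \<le> t" shows "0 < relaxation l t"
proof (rule positive_if_source_decays_slower[OF l relaxation_continuous _ _ t])
  fix t t' :: real assume t: "0 < t" "t < t'"
  then have "(t / t') powr (1 - \<alpha>) \<le> 1" using order_less_1 by (intro powr_le1) auto
  then show "(t / t') powr (1 - \<alpha>) * (relaxation l t + l * J (relaxation l) t)
      \<le> relaxation l t' + l * J (relaxation l) t'" using t by (simp add: relaxation_eq)
qed simp

lemma relaxation_cont_Icc: "0 \<le> a \<Longrightarrow> continuous_on {a..b} (relaxation l)"
  by (rule continuous_on_subset[OF relaxation_continuous]) auto

lemma abel_integral_pos:
  assumes c: "continuous_on {0..t} \<psi>" and t: "0 < t" and pos: "\<And>s. 0 \<le> s \<Longrightarrow> s \<le> t \<Longrightarrow> 0 < \<psi> s"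
  shows "0 < J \<psi> t"
proof -
  obtain m where m: "m \<in> {0..t}" "\<And>s. s \<in> {0..t} \<Longrightarrow> \<psi> m \<le> \<psi> s"
    using continuous_attains_inf[of "{0..t}" \<psi>] c t by auto
  have "0 < \<psi> m * t powr \<alpha> / \<alpha>" using m pos t order_pos by simp
  also have "\<dots> = J (\<lambda>s. \<psi> m) t" using t by (simp add: abel_integral_const)
  also have "\<dots> \<le> J \<psi> t" using m c by (intro abel_integral_mono) auto
  finally show ?thesis .
qed

text \<open>
  The difference \<open>d(t) = u(t) - u(t + h)\<close> solves \<open>d = l F - l J d\<close>, where \<open>F\<close> collects the memory of
  \<open>[0, h]\<close>.  This \<open>F\<close> is a positive mixture of the shifted kernels \<open>(t + \<sigma>)\<^sup>\<alpha>\<^sup>-\<^sup>1\<close> with \<open>\<sigma> \<ge> 0\<close>, each of which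
  decays more slowly than \<open>t\<^sup>\<alpha>\<^sup>-\<^sup>1\<close>.
\<close>

lemma relaxation_strict_antimono:
  assumes l: "0 < l" and t: "0 \<le> t" and h: "0 < h"
  shows "relaxation l (t + h) < relaxation l t"
proof -
  define u where "u = relaxation l"
  have upos: "0 < u t" if "0 \<le> t" for t using relaxation_pos[OF l that] by (simp add: u_def)
  have ueq: "u t = 1 - l * J u t" if "0 \<le> t" for t using relaxation_eq[OF that] by (simp add: u_def)
  have uc: "continuous_on {a..b} u" if "0 \<le> a" for a b
    using relaxation_cont_Icc[OF that] by (simp add: u_def)
  define d where "d t = u t - u (t + h)" for t
  define F where "F t = integral {0..h} (\<lambda>s. (t + h - s) powr (\<alpha> - 1) * u s)" for t
  have shc: "continuous_on {0..} (\<lambda>t. u (t + h))"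
    unfolding u_def by (rule continuous_on_compose2[OF relaxation_continuous]) (use h in \<open>auto intro!: continuous_intros\<close>)
  have dF: "d t + l * J d t = l * F t" if t: "0 \<le> t" for t
  proof -
    have shc': "continuous_on {0..t} (\<lambda>t. u (t + h))" using shc by (rule continuous_on_subset) auto
    define K where "K = integral {h..t + h} (\<lambda>s. (t + h - s) powr (\<alpha> - 1) * u s)"
    have "J d t = J u t - J (\<lambda>s. u (s + h)) t"
      unfolding d_def by (intro abel_integral_diff uc shc') simp
    moreover have "J (\<lambda>s. u (s + h)) t = K"
      using integral_shift_real_ivl[of h h "t + h" "\<lambda>s. (t + h - s) powr (\<alpha> - 1) * u s"]
      by (simp add: abel_integral_def K_def)
    moreover have "J u (t + h) = F t + K"
      unfolding F_def K_def using t h by (intro abel_integral_split uc) auto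
    moreover have "u t = 1 - l * J u t" "u (t + h) = 1 - l * J u (t + h)" using ueq t h by auto
    moreover have "d t = u t - u (t + h)" by (simp add: d_def)
    ultimately show ?thesis by algebra
  qed
  have "0 < d t"
  proof (rule positive_if_source_decays_slower[OF l _ _ _ t])
    show "continuous_on {0..} d" unfolding d_def
      by (intro continuous_intros shc) (simp add: u_def relaxation_continuous)
    have "0 < J u h" using h upos by (intro abel_integral_pos uc) auto
    then show "0 < d 0" using ueq[of 0] ueq[of h] h l by (simp add: d_def)
    fix t t' :: real assume t: "0 < t" "t < t'"
    define r where "r = (t / t') powr (1 - \<alpha>)"
    have i: "(\<lambda>s. (t + h - s) powr (\<alpha> - 1) * u s) integrable_on {0..h}" if "0 \<le> t" for t
      using that h by (intro kernel_mult_integrable uc) auto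
    have "r * F t = integral {0..h} (\<lambda>s. r * ((t + h - s) powr (\<alpha> - 1) * u s))"
      by (simp add: F_def)
    also have "\<dots> \<le> F t'" unfolding F_def
    proof (rule integral_le)
      show "(\<lambda>s. r * ((t + h - s) powr (\<alpha> - 1) * u s)) integrable_on {0..h}"
        using t by (intro integrable_on_mult_right i) auto
      fix s assume s: "s \<in> {0..h}"
      have "0 \<le> (t' - t) * (h - s)" using t s by simp
      then have "t / t' \<le> (t + h - s) / (t' + h - s)" using t s by (simp add: field_simps)
      then have "r * (t + h - s) powr (\<alpha> - 1) \<le> (t' + h - s) powr (\<alpha> - 1)"
        unfolding r_def using s t by (intro kernel_ratio_le) auto
      then show "r * ((t + h - s) powr (\<alpha> - 1) * u s) \<le> (t' + h - s) powr (\<alpha> - 1) * u s"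
        using upos[of s] s by (simp add: mult.assoc[symmetric] mult_right_mono)
    qed (use i[of t'] t in auto)
    finally have "l * (r * F t) \<le> l * F t'" using l by simp
    then show "(t / t') powr (1 - \<alpha>) * (d t + l * J d t) \<le> d t' + l * J d t'"
      using t by (simp add: dF r_def mult.left_commute)
  qed
  then show ?thesis by (simp add: d_def u_def)
qed

lemma relaxation_antimono:
  assumes "0 < l" "0 \<le> s" "s \<le> t" shows "relaxation l t \<le> relaxation l s"
  using relaxation_strict_antimono[OF assms(1,2), of "t - s"] assms by (cases "s = t") auto

lemma relaxation_le_1: "0 < l \<Longrightarrow> 0 \<le> t \<Longrightarrow> relaxation l t \<le> 1"
  using relaxation_antimono[of l 0 t] by simp

text \<open>
  An integrated variation of constants formula.  The convolution of \<open>u\<close> with \<open>z = c + J \<psi>\<close>, together with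
  \<open>l J u = 1 - u\<close>, gives \<open>\<integral>\<^sub>0\<^sup>t (z - c u) = (1/l) \<integral>\<^sub>0\<^sup>t (1 - u(t - r)) \<phi>(r) dr\<close> for \<open>\<phi> = \<psi> + l z \<ge> 0\<close>.  The
  right-hand side is nondecreasing in \<open>t\<close> since \<open>u\<close> is nonincreasing, so the integrand on the left is
  nonnegative.  Working with the integrated formula avoids the derivative of \<open>u\<close>, which is singular at 0.
\<close>

lemma comparison_with_relaxation_upto:
  assumes l: "0 < l" and T: "0 < T"
    and z: "continuous_on {0..T} z" and \<psi>: "continuous_on {0..T} \<psi>"
    and eq: "\<And>t. 0 \<le> t \<Longrightarrow> t \<le> T \<Longrightarrow> z t = c + J \<psi> t"
    and source: "\<And>t. 0 \<le> t \<Longrightarrow> t \<le> T \<Longrightarrow> - l * z t \<le> \<psi> t"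
    and t: "0 \<le> t" "t \<le> T"
  shows "c * relaxation l t \<le> z t"
proof -
  define u where "u = relaxation l"
  define \<phi> where "\<phi> s = \<psi> s + l * z s" for s
  have \<phi>0: "0 \<le> \<phi> s" if "0 \<le> s" "s \<le> T" for s using source[OF that] by (simp add: \<phi>_def)
  have uc: "continuous_on {0..t} u" for t using relaxation_cont_Icc by (simp add: u_def)
  have Ju: "J u t = (1 - u t) / l" if "0 \<le> t" for t using relaxation_eq[OF that, of l] l by (simp add: u_def)
  have u1: "u t \<le> 1" if "0 \<le> t" for t using relaxation_le_1[OF l that] by (simp add: u_def)
  have D: "integral {0..t} (\<lambda>s. z s - c * u s) = integral {0..t} (\<lambda>r. (1 - u (t - r)) / l * \<phi> r)"
    if t: "0 \<le> t" "t \<le> T" for t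
  proof -
    have zc: "continuous_on {0..t} z" and \<psi>c: "continuous_on {0..t} \<psi>"
      using z \<psi> t by (auto elim!: continuous_on_subset)
    have \<phi>c: "continuous_on {0..t} \<phi>" unfolding \<phi>_def by (intro continuous_intros zc \<psi>c)
    have rc: "continuous_on {0..t} (\<lambda>s. u (t - s))"
      by (rule continuous_on_compose2[OF uc[of t]]) (auto intro!: continuous_intros)
    have Jc: "continuous_on {0..t} (J \<psi>)" by (rule abel_integral_continuous[OF \<psi>c])
    have rev: "integral {0..t} (\<lambda>s. u (t - s)) = integral {0..t} u"
    proof -
      have "integral {0..t} u = integral {-t..-0} (\<lambda>s. u (- s))" by (rule Henstock_Kurzweil_Integration.integral_reflect_real[symmetric])
      also have "\<dots> = integral {0 - t..t - t} (\<lambda>s. (\<lambda>s. u (t - s)) (s + t))" by simp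
      also have "\<dots> = integral {0..t} (\<lambda>s. u (t - s))" by (rule integral_shift_real_ivl)
      finally show ?thesis by simp
    qed
    have "integral {0..t} (\<lambda>s. u (t - s) * z s) = integral {0..t} (\<lambda>s. c * u (t - s) + u (t - s) * J \<psi> s)"
      using t by (intro integral_cong) (auto simp: eq algebra_simps)
    also have "\<dots> = integral {0..t} (\<lambda>s. c * u (t - s)) + integral {0..t} (\<lambda>s. u (t - s) * J \<psi> s)"
      by (intro integral_add integrable_continuous_real continuous_intros rc Jc)
    also have "integral {0..t} (\<lambda>s. u (t - s) * J \<psi> s) = integral {0..t} (\<lambda>r. J u (t - r) * \<psi> r)"
      by (rule abel_integral_convolution[OF t(1) uc \<psi>c])
    also have "\<dots> = integral {0..t} (\<lambda>r. (1 - u (t - r)) / l * \<phi> r - z r + u (t - r) * z r)"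
      using l by (intro integral_cong) (auto simp: Ju \<phi>_def field_simps)
    also have "\<dots> = integral {0..t} (\<lambda>r. (1 - u (t - r)) / l * \<phi> r) - integral {0..t} z
        + integral {0..t} (\<lambda>r. u (t - r) * z r)"
      using l by (simp add: integral_add integral_diff integrable_continuous_real continuous_intros rc zc \<phi>c)
    also have "integral {0..t} (\<lambda>s. c * u (t - s)) = integral {0..t} (\<lambda>s. c * u s)"
      using rev by simp
    finally have "integral {0..t} z - integral {0..t} (\<lambda>s. c * u s) = integral {0..t} (\<lambda>r. (1 - u (t - r)) / l * \<phi> r)"
      by simp
    then show ?thesis
      by (subst integral_diff) (auto intro!: integrable_continuous_real continuous_intros zc uc)
  qed
  have mono: "integral {0..t} (\<lambda>s. z s - c * u s) \<le> integral {0..t'} (\<lambda>s. z s - c * u s)"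
    if t: "0 \<le> t" "t \<le> t'" "t' \<le> T" for t t'
  proof -
    have \<phi>c: "continuous_on {a..b} \<phi>" if "0 \<le> a" "b \<le> T" for a b
      unfolding \<phi>_def using that by (intro continuous_intros continuous_on_subset[OF z] continuous_on_subset[OF \<psi>]) auto
    have rc: "continuous_on {a..b} (\<lambda>s. u (t - s))" if "0 \<le> a" "b \<le> t" for a b t
      by (rule continuous_on_compose2[OF uc[of t]]) (use that in \<open>auto intro!: continuous_intros\<close>)
    let ?f = "\<lambda>t r. (1 - u (t - r)) / l * \<phi> r"
    have i: "?f t integrable_on {a..b}" if "0 \<le> a" "b \<le> t" "t \<le> T" for a b t
      using l that by (intro integrable_continuous_real continuous_intros rc \<phi>c) auto
    have "integral {0..t} (?f t) \<le> integral {0..t} (?f t')"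
    proof (intro integral_le i)
      fix s assume s: "s \<in> {0..t}"
      then have "u (t' - s) \<le> u (t - s)" unfolding u_def using t l by (intro relaxation_antimono) auto
      then show "?f t s \<le> ?f t' s" using \<phi>0[of s] s t l by (intro mult_right_mono divide_right_mono) auto
    qed (use t in auto)
    moreover have "0 \<le> integral {t..t'} (?f t')"
      using t l u1 \<phi>0 by (intro integral_nonneg i) auto
    moreover have "integral {0..t'} (?f t') = integral {0..t} (?f t') + integral {t..t'} (?f t')"
      using t by (intro Henstock_Kurzweil_Integration.integral_combine[symmetric] i) auto
    ultimately show ?thesis using D[of t] D[of t'] t by simp
  qed
  define E where "E t = integral {0..t} (\<lambda>s. z s - c * u s)" for t
  have "(E has_real_derivative z t - c * u t) (at t within {0..T})"
    unfolding E_def using t by (intro integral_has_real_derivative continuous_intros z uc) auto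
  then have lim: "((\<lambda>s. (E s - E t) / (s - t)) \<longlongrightarrow> z t - c * u t) (at t within {0..T})"
    by (simp add: has_field_derivative_iff)
  have "0 \<le> z t - c * u t"
  proof (rule tendsto_lowerbound[OF lim])
    show "\<forall>\<^sub>F s in at t within {0..T}. 0 \<le> (E s - E t) / (s - t)"
      unfolding eventually_at_filter
    proof (intro always_eventually allI impI)
      fix s assume "s \<noteq> t" "s \<in> {0..T}"
      then show "0 \<le> (E s - E t) / (s - t)"
        using mono[of s t] mono[of t s] t by (cases "s < t") (auto simp: E_def divide_nonpos_neg)
    qed
    show "at t within {0..T} \<noteq> bot" using t T by (simp add: trivial_limit_within islimpt_Icc)
  qed
  then show ?thesis by (simp add: u_def)
qed

text \<open>
  For a nonlinear equation the inequality \<open>\<psi> \<ge> - l z\<close> is available only as long as \<open>z \<ge> 0\<close>.  Up to a first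
  zero of \<open>z\<close> it holds, and then \<open>z \<ge> c u > 0\<close> at that zero, so no zero exists.
\<close>

lemma comparison_with_relaxation:
  assumes l: "0 < l" and c: "0 < c"
    and z: "continuous_on {0..} z" and \<psi>: "continuous_on {0..} \<psi>"
    and eq: "\<And>t. 0 \<le> t \<Longrightarrow> z t = c + J \<psi> t"
    and source: "\<And>t. 0 \<le> t \<Longrightarrow> 0 \<le> z t \<Longrightarrow> - l * z t \<le> \<psi> t"
    and t: "0 \<le> t"
  shows "c * relaxation l t \<le> z t"
proof -
  have zc: "continuous_on {0..t} z" and \<psi>c: "continuous_on {0..t} \<psi>" for t
    using z \<psi> by (auto elim!: continuous_on_subset)
  have pos: "0 < z t" if t: "0 \<le> t" for t
  proof (rule ccontr)
    assume "\<not> 0 < z t"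
    moreover have "0 < z 0" using eq[of 0] c by simp
    ultimately obtain t' where t': "0 < t'" "z t' = 0" "\<And>s. 0 \<le> s \<Longrightarrow> s < t' \<Longrightarrow> 0 < z s"
      using first_zero[OF z _ t] by (metis not_less)
    have nn: "0 \<le> z s" if "0 \<le> s" "s \<le> t'" for s using t' that by (cases "s = t'") (auto simp: less_imp_le)
    have "c * relaxation l t' \<le> z t'"
      by (rule comparison_with_relaxation_upto[OF l t'(1) zc \<psi>c]) (use eq source nn t' in auto)
    moreover have "0 < c * relaxation l t'" using relaxation_pos[OF l] c t' by simp
    ultimately show False using t' by simp
  qed
  have "0 < t + 1" using t by simp
  then show ?thesis
    by (rule comparison_with_relaxation_upto[OF l _ zc \<psi>c]) (use eq source pos t in \<open>auto simp: less_imp_le\<close>)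
qed

end

section \<open>Algebraic decay of the relaxation function\<close>

context fractional_order begin

text \<open>
  Since \<open>u\<close> decreases, \<open>u(t) t\<^sup>\<alpha>/\<alpha> \<le> J u t\<close>, and \<open>l J u = 1 - u \<le> 1\<close>.
\<close>

lemma relaxation_upper_rate:
  assumes l: "0 < l" and t: "0 < t"
  shows "relaxation l t \<le> \<alpha> / l * t powr (- \<alpha>)"
proof -
  have "relaxation l t * t powr \<alpha> / \<alpha> = J (\<lambda>s. relaxation l t) t"
    using t by (simp add: abel_integral_const)
  also have "\<dots> \<le> J (relaxation l) t"
    using l by (intro abel_integral_mono relaxation_cont_Icc relaxation_antimono) auto
  also have "\<dots> = (1 - relaxation l t) / l" using relaxation_eq[of t l] l t by simp
  also have "\<dots> \<le> 1 / l" using relaxation_pos[OF l, of t] t l by (intro divide_right_mono) auto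
  finally show ?thesis using t l order_pos by (simp add: powr_minus field_simps)
qed

text \<open>
  In \<open>1 - u(T) = l J u T\<close> the left side is close to 1 for large \<open>T\<close>.  The part of the memory from
  \<open>[0, \<epsilon> T]\<close> is at most \<open>\<epsilon>\<^sup>1\<^sup>-\<^sup>\<alpha> l J u (\<epsilon> T) \<le> \<epsilon>\<^sup>1\<^sup>-\<^sup>\<alpha>\<close>, again by comparison of the two kernels, and
  the rest is at most \<open>l u(\<epsilon> T) T\<^sup>\<alpha>/\<alpha>\<close>.  So \<open>u(\<epsilon> T)\<close> is at least a multiple of \<open>T\<^sup>-\<^sup>\<alpha>\<close>.
\<close>

lemma relaxation_lower_rate:
  assumes l: "0 < l"
  shows "\<exists>c T. 0 < c \<and> 0 < T \<and> (\<forall>t\<ge>T. c * t powr (- \<alpha>) \<le> relaxation l t)"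
proof -
  \<comment> \<open>With \<open>\<epsilon>\<^sup>1\<^sup>-\<^sup>\<alpha> = 1/4\<close>, and \<open>u(T) \<le> 1/4\<close> for \<open>T \<ge> S\<close>, at least 1/2 is left for the recent memory.\<close>
  define \<epsilon> where "\<epsilon> = (1 / 4 :: real) powr (1 / (1 - \<alpha>))"
  have \<epsilon>: "0 < \<epsilon>" "\<epsilon> < 1" "\<epsilon> powr (1 - \<alpha>) = 1 / 4"
    using order_less_1 powr_less_mono2[of "1 / (1 - \<alpha>)" "1 / 4" 1]
    by (auto simp: \<epsilon>_def powr_powr)
  define S where "S = (4 * \<alpha> / l) powr (1 / \<alpha>)"
  have S: "0 < S" "S powr \<alpha> = 4 * \<alpha> / l" using l order_pos by (auto simp: S_def powr_powr)
  have "\<alpha> / (2 * l) * \<epsilon> powr \<alpha> * t powr (- \<alpha>) \<le> relaxation l t" if t: "\<epsilon> * S \<le> t" for t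
  proof -
    define u where "u = relaxation l"
    have uc: "continuous_on {a..b} u" if "0 \<le> a" for a b
      using relaxation_cont_Icc[OF that] by (simp add: u_def)
    define T where "T = t / \<epsilon>"
    have t0: "0 < t" using t \<epsilon> S by (meson mult_pos_pos less_le_trans)
    have T: "0 < T" "t < T" "t / T = \<epsilon>" "S \<le> T"
      using t t0 \<epsilon> by (auto simp: T_def field_simps)
    have "u T \<le> \<alpha> / l * T powr (- \<alpha>)"
      using relaxation_upper_rate[OF l T(1)] by (simp add: u_def)
    also have "\<dots> \<le> \<alpha> / l * S powr (- \<alpha>)"
      using T S l order_pos by (intro mult_left_mono powr_mono2') auto
    also have "\<dots> = 1 / 4" using S l order_pos by (simp add: powr_minus)
    finally have uT: "u T \<le> 1 / 4" .
    have "integral {0..t} (\<lambda>s. (T - s) powr (\<alpha> - 1) * u s)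
        \<le> integral {0..t} (\<lambda>s. 1 / 4 * ((t - s) powr (\<alpha> - 1) * u s))"
    proof (rule integral_le_open_right)
      show "(\<lambda>s. 1 / 4 * ((t - s) powr (\<alpha> - 1) * u s)) integrable_on {0..t}"
        by (intro integrable_on_mult_right kernel_mult_integrable uc) auto
      fix s assume s: "0 \<le> s" "s < t"
      have "(t - s) / (T - s) \<le> t / T" using s T(1,2) mult_left_mono[of t T s] by (simp add: field_simps)
      then have "(T - s) powr (\<alpha> - 1) \<le> \<epsilon> powr (1 - \<alpha>) * (t - s) powr (\<alpha> - 1)"
        using s T by (intro kernel_ratio_ge) auto
      then show "(T - s) powr (\<alpha> - 1) * u s \<le> 1 / 4 * ((t - s) powr (\<alpha> - 1) * u s)"
        using relaxation_pos[OF l, of s] s unfolding \<epsilon>(3)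
        by (simp add: u_def mult.assoc[symmetric] mult_right_mono del: times_divide_eq_left)
    qed (use T in \<open>auto intro!: kernel_mult_integrable uc\<close>)
    also have "\<dots> = 1 / 4 * J u t" by (simp add: abel_integral_def)
    also have "J u t = (1 - u t) / l" using relaxation_eq[of t l] l t0 by (simp add: u_def)
    also have "1 / 4 * ((1 - u t) / l) \<le> 1 / 4 * (1 / l)"
      using relaxation_pos[OF l, of t] t0 l unfolding u_def
      by (intro mult_left_mono divide_right_mono) auto
    finally have 1: "integral {0..t} (\<lambda>s. (T - s) powr (\<alpha> - 1) * u s) \<le> 1 / 4 * (1 / l)" .
    have "integral {t..T} (\<lambda>s. (T - s) powr (\<alpha> - 1) * u s) \<le> u t * ((T - t) powr \<alpha> - (T - T) powr \<alpha>) / \<alpha>"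
      using T t0 l by (intro kernel_integral_le uc) (auto simp: u_def intro!: relaxation_antimono)
    also have "\<dots> \<le> u t * T powr \<alpha> / \<alpha>"
      using T t0 order_pos relaxation_pos[OF l, of t] unfolding u_def
      by (intro divide_right_mono mult_left_mono) (auto intro!: powr_mono2)
    finally have 2: "integral {t..T} (\<lambda>s. (T - s) powr (\<alpha> - 1) * u s) \<le> u t * T powr \<alpha> / \<alpha>" .
    have "J u T \<le> 1 / 4 * (1 / l) + u t * T powr \<alpha> / \<alpha>"
      using abel_integral_split[OF uc[of 0 T], of t] 1 2 T t0 by simp
    then have "l * J u T \<le> l * (1 / 4 * (1 / l) + u t * T powr \<alpha> / \<alpha>)"
      using l by (intro mult_left_mono) auto
    also have "\<dots> = 1 / 4 + l * (u t * T powr \<alpha> / \<alpha>)" using l by (simp add: distrib_left)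
    finally have "1 - u T \<le> 1 / 4 + l * (u t * T powr \<alpha> / \<alpha>)"
      using relaxation_eq[of T l] T by (simp add: u_def)
    then have "1 / 2 \<le> l * (u t * T powr \<alpha> / \<alpha>)" using uT by simp
    then have "\<alpha> / (2 * l) * T powr (- \<alpha>) \<le> u t"
      using T l order_pos by (simp add: powr_minus field_simps)
    moreover have "T powr (- \<alpha>) = \<epsilon> powr \<alpha> * t powr (- \<alpha>)"
      using \<epsilon> t0 by (simp add: T_def powr_divide powr_minus field_simps)
    ultimately show ?thesis by (simp add: u_def mult.assoc)
  qed
  moreover have "0 < \<alpha> / (2 * l) * \<epsilon> powr \<alpha>" "0 < \<epsilon> * S" using l order_pos \<epsilon> S by auto
  ultimately show ?thesis by blast
qed

end

section \<open>Ordering of solutions\<close>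

context fractional_order begin

lemma abel_solution_reflect:
  "abel_solution \<alpha> G \<eta> x \<Longrightarrow> abel_solution \<alpha> (\<lambda>y. - G (- y)) (- \<eta>) (\<lambda>t. - x t)"
  unfolding abel_solution_def by (auto simp: abel_integral_minus intro!: continuous_intros)

lemma abel_solution_const: "abel_solution \<alpha> (\<lambda>y. 0) M (\<lambda>t. M)"
  unfolding abel_solution_def using abel_integral_cmult[of 0 "\<lambda>s. 0"] by auto

text \<open>
  Two fields are allowed so that a constant \<open>M\<close>, which solves the equation with field 0, can serve as
  a barrier wherever the field has the right sign at \<open>M\<close>.
\<close>

lemma abel_solution_order:
  assumes x: "abel_solution \<alpha> G \<eta> x" and x': "abel_solution \<alpha> G' \<eta>' x'" and \<eta>: "\<eta> < \<eta>'" and L: "0 \<le> L"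
    and cont: "continuous_on {0..} (\<lambda>s. G (x s))" "continuous_on {0..} (\<lambda>s. G' (x' s))"
    and one_sided: "\<And>s. 0 \<le> s \<Longrightarrow> x s \<le> x' s \<Longrightarrow> G (x s) - G' (x' s) \<le> L * (x' s - x s)"
    and t: "0 \<le> t"
  shows "x t < x' t"
proof -
  have "0 < (\<eta>' - \<eta>) * relaxation (L + 1) t" using \<eta> L t relaxation_pos[of "L + 1" t] by simp
  also have "\<dots> \<le> x' t - x t"
  proof (rule comparison_with_relaxation[where \<psi> = "\<lambda>s. G' (x' s) - G (x s)"])
    show "continuous_on {0..} (\<lambda>t. x' t - x t)"
      using x x' by (auto simp: abel_solution_def intro!: continuous_intros)
    show "continuous_on {0..} (\<lambda>s. G' (x' s) - G (x s))" by (intro continuous_intros cont)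
    fix s :: real assume s: "0 \<le> s"
    have c: "continuous_on {0..s} (\<lambda>s. G (x s))" "continuous_on {0..s} (\<lambda>s. G' (x' s))"
      using cont by (auto elim: continuous_on_subset)
    show "x' s - x s = \<eta>' - \<eta> + J (\<lambda>s. G' (x' s) - G (x s)) s"
      using abel_solution_eq[OF x s] abel_solution_eq[OF x' s] abel_integral_diff[OF c(2,1)] by simp
    show "- (L + 1) * (x' s - x s) \<le> G' (x' s) - G (x s)" if "0 \<le> x' s - x s"
      using one_sided[OF s] that by (simp add: algebra_simps)
  qed (use \<eta> L t in auto)
  finally show ?thesis by simp
qed

end

section \<open>Solutions for a dissipative field\<close>

locale dissipative_field = fractional_order +
  fixes G :: "real \<Rightarrow> real"
  assumes locally_lipschitz: "\<And>R. \<exists>L. L-lipschitz_on {-R..R} G"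
    and inward: "\<exists>R. \<forall>y. R < \<bar>y\<bar> \<longrightarrow> G y * y < 0"
    and hyperbolic: "\<And>y. G y = 0 \<Longrightarrow> \<exists>D. D \<noteq> 0 \<and> (G has_real_derivative D) (at y)"
begin

lemma field_continuous: "continuous_on A G"
proof -
  have "isCont G y" for y
  proof -
    obtain L where "L-lipschitz_on {-(\<bar>y\<bar> + 1)..\<bar>y\<bar> + 1} G" using locally_lipschitz by blast
    then have "continuous_on {-(\<bar>y\<bar> + 1)..\<bar>y\<bar> + 1} G" by (rule lipschitz_on_continuous_on)
    then show ?thesis by (rule continuous_on_interior) (auto simp: interior_atLeastAtMost_real)
  qed
  then show ?thesis by (simp add: continuous_at_imp_continuous_on)
qed

lemma field_compose_continuous: "continuous_on A y \<Longrightarrow> continuous_on A (\<lambda>s. G (y s))"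
  by (rule continuous_on_compose2[OF field_continuous[of UNIV]]) auto

lemma solution_unique:
  assumes x: "abel_solution \<alpha> G \<eta> x" and x': "abel_solution \<alpha> G \<eta> x'" and t: "0 \<le> t"
  shows "x t = x' t"
proof -
  have "bounded (x ` {0..t} \<union> x' ` {0..t})"
    using abel_solution_continuous[OF x] abel_solution_continuous[OF x']
    by (intro bounded_Un[THEN iffD2] conjI compact_imp_bounded compact_continuous_image) auto
  then obtain R where R: "\<And>y. y \<in> x ` {0..t} \<union> x' ` {0..t} \<Longrightarrow> \<bar>y\<bar> \<le> R"
    unfolding bounded_iff by force
  obtain L where L: "L-lipschitz_on {-R..R} G" using locally_lipschitz by blast
  obtain \<mu> where "halving_rate L \<mu>" using halving_rate_exists lipschitz_on_nonneg[OF L] by blast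
  from abel_solution_stability[OF this t L x x'] R show ?thesis
    by (fastforce simp: abs_le_iff)
qed

text \<open>
  The field frozen outside \<open>[- R, R]\<close> is globally Lipschitz.  Its solution cannot cross the barriers
  \<open>R\<close> and \<open>- R\<close>, hence never meets the modified part of the field.
\<close>

lemma bounded_solution_exists:
  assumes \<eta>: "\<bar>\<eta>\<bar> < R" and R: "G R < 0" "0 < G (- R)"
  shows "\<exists>x. abel_solution \<alpha> G \<eta> x \<and> (\<forall>t\<ge>0. \<bar>x t\<bar> \<le> R)"
proof -
  obtain L where L: "L-lipschitz_on {-R..R} G" using locally_lipschitz by blast
  have L0: "0 \<le> L" using L by (rule lipschitz_on_nonneg)
  define H where "H y = G (max (- R) (min R y))" for y
  have lip: "\<bar>H y - H y'\<bar> \<le> L * \<bar>y - y'\<bar>" for y y'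
  proof -
    have "\<bar>H y - H y'\<bar> \<le> L * \<bar>max (- R) (min R y) - max (- R) (min R y')\<bar>"
      using lipschitz_onD[OF L, of "max (- R) (min R y)" "max (- R) (min R y')"] \<eta>
      by (auto simp: H_def dist_real_def)
    also have "\<dots> \<le> L * \<bar>y - y'\<bar>" using L0 by (intro mult_left_mono) auto
    finally show ?thesis .
  qed
  then have HL: "L-lipschitz_on UNIV H" using L0 by (intro lipschitz_onI) (auto simp: dist_real_def)
  then obtain x where x: "abel_solution \<alpha> H \<eta> x" using abel_solution_exists_lipschitz by blast
  have c: "continuous_on {0..} (\<lambda>s. H (x s))"
    using x by (intro continuous_on_compose2[OF lipschitz_on_continuous_on[OF HL]]) (auto simp: abel_solution_def)
  have HR: "H R < 0" "0 < H (- R)" using \<eta> R by (auto simp: H_def)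
  have up: "x t < R" if t: "0 \<le> t" for t
  proof (rule abel_solution_order[OF x abel_solution_const _ L0 c _ _ t])
    show "H (x s) - 0 \<le> L * (R - x s)" if "x s \<le> R" for s
      using lip[of "x s" R] HR that by (simp add: abs_le_iff)
  qed (use \<eta> in auto)
  have lo: "- R < x t" if t: "0 \<le> t" for t
  proof (rule abel_solution_order[OF abel_solution_const x _ L0 _ c _ t])
    show "0 - H (x s) \<le> L * (x s - - R)" if "- R \<le> x s" for s
      using lip[of "x s" "- R"] HR that by (simp add: abs_le_iff)
  qed (use \<eta> in auto)
  have "H (x s) = G (x s)" if "0 \<le> s" for s using up[OF that] lo[OF that] by (simp add: H_def)
  then have "J (\<lambda>s. H (x s)) t = J (\<lambda>s. G (x s)) t" for t by (intro abel_integral_cong) auto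
  then have "abel_solution \<alpha> G \<eta> x" using x by (simp add: abel_solution_def)
  moreover have "\<bar>x t\<bar> \<le> R" if "0 \<le> t" for t using up[OF that] lo[OF that] by simp
  ultimately show ?thesis by blast
qed

lemma inward_radius: "\<exists>R>R0. G R < 0 \<and> 0 < G (- R)"
proof -
  obtain R where R: "\<And>y. R < \<bar>y\<bar> \<Longrightarrow> G y * y < 0" using inward by blast
  define r where "r = max (max R R0) 0 + 1"
  have "R < r" "R0 < r" "0 < r" by (auto simp: r_def)
  moreover have "G r * r < 0" "G (- r) * (- r) < 0" using R[of r] R[of "- r"] \<open>R < r\<close> \<open>0 < r\<close> by auto
  ultimately show ?thesis by (auto simp: mult_less_0_iff zero_less_mult_iff intro!: exI[of _ r])
qed

definition sol :: "real \<Rightarrow> real \<Rightarrow> real" where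
  "sol \<eta> = (SOME x. abel_solution \<alpha> G \<eta> x)"

lemma sol_solution: "abel_solution \<alpha> G \<eta> (sol \<eta>)"
proof -
  obtain R where "\<bar>\<eta>\<bar> < R" "G R < 0" "0 < G (- R)" using inward_radius by blast
  then have "\<exists>x. abel_solution \<alpha> G \<eta> x" using bounded_solution_exists by blast
  then show ?thesis unfolding sol_def by (rule someI_ex)
qed

lemma sol_unique: "abel_solution \<alpha> G \<eta> x \<Longrightarrow> 0 \<le> t \<Longrightarrow> x t = sol \<eta> t"
  using solution_unique sol_solution by blast

lemma sol_continuous: "continuous_on {0..} (sol \<eta>)"
  using sol_solution[of \<eta>] by (simp add: abel_solution_def)

lemma sol_bounded: "\<exists>R. \<forall>\<eta> t. \<bar>\<eta>\<bar> \<le> R0 \<longrightarrow> 0 \<le> t \<longrightarrow> \<bar>sol \<eta> t\<bar> \<le> R"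
proof -
  obtain R where R: "R0 < R" "G R < 0" "0 < G (- R)" using inward_radius by blast
  have "\<bar>sol \<eta> t\<bar> \<le> R" if "\<bar>\<eta>\<bar> \<le> R0" "0 \<le> t" for \<eta> t
    using bounded_solution_exists[of \<eta> R] that R sol_unique[of \<eta> _ t] by fastforce
  then show ?thesis by blast
qed

lemma sol_strict_mono:
  assumes "\<eta> < \<eta>'" and t: "0 \<le> t" shows "sol \<eta> t < sol \<eta>' t"
proof -
  obtain R where R: "\<And>\<xi> s. \<bar>\<xi>\<bar> \<le> max \<bar>\<eta>\<bar> \<bar>\<eta>'\<bar> \<Longrightarrow> 0 \<le> s \<Longrightarrow> \<bar>sol \<xi> s\<bar> \<le> R"
    using sol_bounded by blast
  obtain L where L: "L-lipschitz_on {-R..R} G" using locally_lipschitz by blast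
  show ?thesis
  proof (rule abel_solution_order[OF sol_solution sol_solution assms(1) lipschitz_on_nonneg[OF L] _ _ _ t])
    fix s :: real assume s: "0 \<le> s" and le: "sol \<eta> s \<le> sol \<eta>' s"
    have "\<bar>sol \<eta> s\<bar> \<le> R" "\<bar>sol \<eta>' s\<bar> \<le> R" using R s by auto
    then show "G (sol \<eta> s) - G (sol \<eta>' s) \<le> L * (sol \<eta>' s - sol \<eta> s)"
      using lipschitz_onD[OF L, of "sol \<eta> s" "sol \<eta>' s"] le by (auto simp: dist_real_def abs_le_iff)
  qed (intro field_compose_continuous sol_continuous)+
qed

lemma sol_mono: "\<eta> \<le> \<eta>' \<Longrightarrow> 0 \<le> t \<Longrightarrow> sol \<eta> t \<le> sol \<eta>' t"
  using sol_strict_mono[of \<eta> \<eta>' t] by (cases "\<eta> = \<eta>'") auto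

lemma sol_inj: "0 \<le> t \<Longrightarrow> sol \<eta> t = sol \<eta>' t \<Longrightarrow> \<eta> = \<eta>'"
  using sol_strict_mono[of \<eta> \<eta>' t] sol_strict_mono[of \<eta>' \<eta> t] by (cases \<eta> \<eta>' rule: linorder_cases) auto

lemma sol_equilibrium: "G \<eta> = 0 \<Longrightarrow> 0 \<le> t \<Longrightarrow> sol \<eta> t = \<eta>"
  using sol_unique[of \<eta> "\<lambda>t. \<eta>" t] abel_solution_const[of \<eta>] by (simp add: abel_solution_def)

lemma sol_continuous_initial:
  assumes t: "0 \<le> t" shows "continuous_on {a..b} (\<lambda>\<eta>. sol \<eta> t)"
proof -
  define R0 where "R0 = max \<bar>a\<bar> \<bar>b\<bar>"
  obtain R where R: "\<And>\<eta> s. \<bar>\<eta>\<bar> \<le> R0 \<Longrightarrow> 0 \<le> s \<Longrightarrow> \<bar>sol \<eta> s\<bar> \<le> R"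
    using sol_bounded by blast
  obtain L where L: "L-lipschitz_on {-R..R} G" using locally_lipschitz by blast
  obtain \<mu> where \<mu>: "halving_rate L \<mu>" using halving_rate_exists lipschitz_on_nonneg[OF L] by blast
  have "(2 * exp (\<mu> * t))-lipschitz_on {a..b} (\<lambda>\<eta>. sol \<eta> t)"
  proof (rule lipschitz_onI)
    fix \<eta> \<eta>' assume "\<eta> \<in> {a..b}" "\<eta>' \<in> {a..b}"
    then have "\<bar>\<eta>\<bar> \<le> R0" "\<bar>\<eta>'\<bar> \<le> R0" by (auto simp: R0_def)
    then have "sol \<eta> ` {0..t} \<subseteq> {-R..R}" "sol \<eta>' ` {0..t} \<subseteq> {-R..R}"
      using R by (force simp: abs_le_iff)+
    from abel_solution_stability[OF \<mu> t L sol_solution sol_solution this]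
    show "dist (sol \<eta> t) (sol \<eta>' t) \<le> 2 * exp (\<mu> * t) * dist \<eta> \<eta>'"
      by (simp add: dist_real_def mult_ac)
  qed simp
  then show ?thesis by (rule lipschitz_on_continuous_on)
qed

lemma sol_surj_between:
  assumes "p \<le> q" "G p = 0" "G q = 0" "p \<le> \<eta>" "\<eta> \<le> q" "0 \<le> t"
  shows "\<exists>\<zeta>. p \<le> \<zeta> \<and> \<zeta> \<le> q \<and> sol \<zeta> t = \<eta>"
  using IVT'[of "\<lambda>\<zeta>. sol \<zeta> t" p \<eta> q] assms sol_continuous_initial[of t p q]
  by (auto simp: sol_equilibrium)

text \<open>
  Comparison of solutions needs a gap between the initial values, so the barriers are constants \<open>m < \<eta>\<close>
  close to \<open>\<eta>\<close>, where the field is still positive.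
\<close>

lemma sol_ge_initial:
  assumes \<eta>: "0 < G \<eta>" and t: "0 \<le> t" shows "\<eta> \<le> sol \<eta> t"
proof -
  obtain R where R: "\<And>\<xi> s. \<bar>\<xi>\<bar> \<le> \<bar>\<eta>\<bar> + 1 \<Longrightarrow> 0 \<le> s \<Longrightarrow> \<bar>sol \<xi> s\<bar> \<le> R"
    using sol_bounded by blast
  define R' where "R' = max R (\<bar>\<eta>\<bar> + 1)"
  obtain L where L: "L-lipschitz_on {-R'..R'} G" using locally_lipschitz by blast
  have "isCont G \<eta>" using field_continuous[of UNIV] by (simp add: continuous_on_eq_continuous_at)
  then have "\<forall>\<^sub>F m in at_left \<eta>. 0 < G m"
    using \<eta> by (intro order_tendstoD(1)[of G "G \<eta>"]) (auto simp: isCont_def intro: filterlim_mono at_le)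
  moreover have "\<forall>\<^sub>F m in at_left \<eta>. \<eta> - 1 < m"
    using eventually_at_left_real[of "\<eta> - 1" \<eta>] by (auto elim: eventually_mono)
  moreover have "\<forall>\<^sub>F m in at_left \<eta>. m < \<eta>" by (simp add: eventually_at_filter)
  ultimately have "\<forall>\<^sub>F m in at_left \<eta>. m \<le> sol \<eta> t"
  proof eventually_elim
    case (elim m)
    have "m < sol \<eta> t"
    proof (rule abel_solution_order[OF abel_solution_const sol_solution elim(3) lipschitz_on_nonneg[OF L] _ _ _ t])
      fix s :: real assume s: "0 \<le> s" "m \<le> sol \<eta> s"
      have "\<bar>sol \<eta> s\<bar> \<le> R" by (rule R) (use s in auto)
      then have "sol \<eta> s \<in> {-R'..R'}" "m \<in> {-R'..R'}" using elim by (auto simp: R'_def)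
      from lipschitz_onD[OF L this] show "0 - G (sol \<eta> s) \<le> L * (sol \<eta> s - m)"
        using elim(1) s by (simp add: dist_real_def abs_le_iff)
    qed (auto intro!: field_compose_continuous sol_continuous)
    then show ?case by simp
  qed
  then show ?thesis
    by (rule tendsto_upperbound[OF tendsto_ident_at]) simp
qed

end

section \<open>Convergence to equilibria\<close>

context dissipative_field begin

text \<open>
  The quotient \<open>G y / (q - y)\<close> extends continuously to \<open>y = q\<close> by \<open>- G' q\<close>.  This value is nonnegative as a
  limit of positive numbers and nonzero by hyperbolicity, so the quotient has positive extrema on
  \<open>[\<eta>, q]\<close>.
\<close>

lemma linear_bounds_below_equilibrium:
  assumes \<eta>: "\<eta> < q" and q: "G q = 0" and pos: "\<And>y. \<eta> \<le> y \<Longrightarrow> y < q \<Longrightarrow> 0 < G y"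
  shows "\<exists>k K. 0 < k \<and> 0 < K \<and> (\<forall>y. \<eta> \<le> y \<longrightarrow> y \<le> q \<longrightarrow> k * (q - y) \<le> G y \<and> G y \<le> K * (q - y))"
proof -
  obtain D where D: "D \<noteq> 0" "(G has_real_derivative D) (at q)" using hyperbolic[OF q] by blast
  have lim: "((\<lambda>y. G y / (q - y)) \<longlongrightarrow> - D) (at q within A)" for A
  proof -
    have "((\<lambda>y. - ((G y - G q) / (y - q))) \<longlongrightarrow> - D) (at q within A)"
      using D(2) by (intro tendsto_minus) (auto simp: has_field_derivative_iff intro: tendsto_within_subset)
    then show ?thesis using q by (simp add: minus_divide_right)
  qed
  have "\<forall>\<^sub>F y in at_left q. 0 \<le> G y / (q - y)"
    using eventually_at_left_real[OF \<eta>] by eventually_elim (use pos in \<open>auto intro!: divide_nonneg_nonneg simp: less_imp_le\<close>)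
  then have "0 \<le> - D" by (rule tendsto_lowerbound[OF lim]) simp
  then have D0: "0 < - D" using D by simp
  define h where "h y = (if y = q then - D else G y / (q - y))" for y
  have hc: "continuous_on {\<eta>..q} h"
    unfolding continuous_on_def
  proof
    fix y assume y: "y \<in> {\<eta>..q}"
    show "(h \<longlongrightarrow> h y) (at y within {\<eta>..q})"
    proof (cases "y = q")
      case True
      have "((\<lambda>y. G y / (q - y)) \<longlongrightarrow> h y) (at y within {\<eta>..q})" using lim True by (simp add: h_def)
      then show ?thesis
        by (rule Lim_transform_eventually) (use True in \<open>auto simp: eventually_at_filter h_def\<close>)
    next
      case False
      have "((\<lambda>y. G y / (q - y)) \<longlongrightarrow> G y / (q - y)) (at y within {\<eta>..q})"
        using False field_continuous[of "{\<eta>..q}"] y by (intro tendsto_intros) (auto simp: continuous_on_def)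
      moreover have "\<forall>\<^sub>F z in at y within {\<eta>..q}. G z / (q - z) = h z"
      proof -
        have "\<forall>\<^sub>F z in nhds y. z \<noteq> q" using False t1_space_nhds by blast
        then show ?thesis unfolding eventually_at_filter by eventually_elim (auto simp: h_def)
      qed
      ultimately show ?thesis using Lim_transform_eventually False by (fastforce simp: h_def)
    qed
  qed
  have hpos: "0 < h y" if "y \<in> {\<eta>..q}" for y using that pos[of y] D0 by (auto simp: h_def)
  obtain m where m: "m \<in> {\<eta>..q}" "\<And>y. y \<in> {\<eta>..q} \<Longrightarrow> h m \<le> h y"
    using continuous_attains_inf[of "{\<eta>..q}" h] hc \<eta> by auto
  obtain M where M: "M \<in> {\<eta>..q}" "\<And>y. y \<in> {\<eta>..q} \<Longrightarrow> h y \<le> h M"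
    using continuous_attains_sup[of "{\<eta>..q}" h] hc \<eta> by auto
  have G: "G y = h y * (q - y)" for y using q by (simp add: h_def)
  have "h m * (q - y) \<le> G y \<and> G y \<le> h M * (q - y)" if "\<eta> \<le> y" "y \<le> q" for y
    unfolding G[of y] using m(2)[of y] M(2)[of y] that by (intro conjI mult_right_mono) auto
  then show ?thesis using hpos m M by blast
qed

text \<open>
  For \<open>w = q - x\<close> the equation reads \<open>w = (q - \<eta>) - J (G \<circ> x)\<close> with \<open>G \<circ> x\<close> between \<open>k w\<close> and \<open>K w\<close>, so both
  bounds are instances of the comparison with relaxation functions.
\<close>

lemma relaxation_bounds:
  assumes \<eta>: "\<eta> < q" and q: "G q = 0" and pos: "\<And>y. \<eta> \<le> y \<Longrightarrow> y < q \<Longrightarrow> 0 < G y"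
  shows "\<exists>k K. 0 < k \<and> 0 < K \<and> (\<forall>t\<ge>0. (q - \<eta>) * relaxation K t \<le> q - sol \<eta> t
           \<and> q - sol \<eta> t \<le> (q - \<eta>) * relaxation k t)"
proof -
  obtain k K where k: "0 < k" and K: "0 < K"
    and bounds: "\<And>y. \<eta> \<le> y \<Longrightarrow> y \<le> q \<Longrightarrow> k * (q - y) \<le> G y \<and> G y \<le> K * (q - y)"
    using linear_bounds_below_equilibrium[OF assms] by blast
  have range: "\<eta> \<le> sol \<eta> t" "sol \<eta> t \<le> q" if "0 \<le> t" for t
    using sol_ge_initial[OF pos that] sol_strict_mono[OF \<eta> that] sol_equilibrium[OF q that] \<eta> by auto
  have xc: "continuous_on {0..t} (sol \<eta>)" for t
    by (rule continuous_on_subset[OF sol_continuous]) auto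
  have eq: "q - sol \<eta> t = (q - \<eta>) + J (\<lambda>s. - G (sol \<eta> s)) t" if "0 \<le> t" for t
    using abel_solution_eq[OF sol_solution that, of \<eta>] by (simp add: abel_integral_minus)
  have lower: "(q - \<eta>) * relaxation K t \<le> q - sol \<eta> t" if t: "0 \<le> t" for t
  proof (rule comparison_with_relaxation[OF K _ _ _ eq _ t])
    show "continuous_on {0..} (\<lambda>t. q - sol \<eta> t)" "continuous_on {0..} (\<lambda>s. - G (sol \<eta> s))"
      by (intro continuous_intros field_compose_continuous sol_continuous)+
  qed (use \<eta> bounds range in auto)
  have upper: "q - sol \<eta> t \<le> (q - \<eta>) * relaxation k t" if t: "0 \<le> t" for t
  proof (rule field_le_epsilon)
    fix e :: real assume e: "0 < e"
    \<comment> \<open>Enlarging the initial value by \<open>e\<close> provides the initial gap that the comparison requires.\<close>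
    define c where "c = q - \<eta> + e"
    have "e * relaxation k t \<le> c * relaxation k t - (q - sol \<eta> t)"
    proof (rule comparison_with_relaxation[where \<psi> = "\<lambda>s. (- k * c) * relaxation k s + G (sol \<eta> s)", OF k e _ _ _ _ t])
      show "continuous_on {0..} (\<lambda>t. c * relaxation k t - (q - sol \<eta> t))"
        "continuous_on {0..} (\<lambda>s. (- k * c) * relaxation k s + G (sol \<eta> s))"
        by (intro continuous_intros field_compose_continuous sol_continuous relaxation_continuous)+
      fix s :: real assume s: "0 \<le> s"
      define Q where "Q = J (\<lambda>s. (- k * c) * relaxation k s + G (sol \<eta> s)) s"
      have "Q = (- k * c) * J (relaxation k) s + J (\<lambda>s. G (sol \<eta> s)) s"
        using abel_integral_add[of s "\<lambda>s. (- k * c) * relaxation k s" "\<lambda>s. G (sol \<eta> s)"]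
        unfolding abel_integral_cmult Q_def by (simp add: continuous_intros relaxation_cont_Icc field_compose_continuous xc)
      moreover have "q - sol \<eta> s = (q - \<eta>) - J (\<lambda>s. G (sol \<eta> s)) s"
        using eq[OF s] by (simp add: abel_integral_minus)
      moreover have "relaxation k s = 1 - k * J (relaxation k) s" by (rule relaxation_eq[OF s])
      moreover have "c = q - \<eta> + e" by (simp add: c_def)
      ultimately have "c * relaxation k s - (q - sol \<eta> s) = e + Q" by algebra
      then show "c * relaxation k s - (q - sol \<eta> s) = e + J (\<lambda>s. (- k * c) * relaxation k s + G (sol \<eta> s)) s"
        by (simp only: Q_def)
      show "- k * (c * relaxation k s - (q - sol \<eta> s)) \<le> - k * c * relaxation k s + G (sol \<eta> s)"
        using bounds[OF range[OF s]] by (simp add: algebra_simps)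
    qed
    then have "q - sol \<eta> t \<le> (c - e) * relaxation k t" by (simp add: algebra_simps)
    then show "q - sol \<eta> t \<le> (q - \<eta>) * relaxation k t + e" using e by (simp add: c_def)
  qed
  show ?thesis using k K lower upper by blast
qed

lemma converges_up_to_equilibrium:
  assumes \<eta>: "\<eta> < q" and q: "G q = 0" and pos: "\<And>y. \<eta> \<le> y \<Longrightarrow> y < q \<Longrightarrow> 0 < G y"
  shows "(sol \<eta> \<longlongrightarrow> q) at_top" and "rate_of_convergence \<alpha> (sol \<eta>) q"
proof -
  obtain k K where k: "0 < k" and K: "0 < K"
    and lower: "\<And>t. 0 \<le> t \<Longrightarrow> (q - \<eta>) * relaxation K t \<le> q - sol \<eta> t"
    and upper: "\<And>t. 0 \<le> t \<Longrightarrow> q - sol \<eta> t \<le> (q - \<eta>) * relaxation k t"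
    using relaxation_bounds[OF assms] by blast
  obtain c T where c: "0 < c" "0 < T" "\<And>t. T \<le> t \<Longrightarrow> c * t powr (- \<alpha>) \<le> relaxation K t"
    using relaxation_lower_rate[OF K] by blast
  define c' where "c' = (q - \<eta>) * c"
  define C where "C = (q - \<eta>) * (\<alpha> / k)"
  have pos: "0 < c'" "0 < C" using \<eta> c k order_pos by (auto simp: c'_def C_def)
  have bounds: "c' * t powr (- \<alpha>) \<le> q - sol \<eta> t" "q - sol \<eta> t \<le> C * t powr (- \<alpha>)" if t: "T \<le> t" for t
  proof -
    have t0: "0 < t" using t c by simp
    have "c' * t powr (- \<alpha>) = (q - \<eta>) * (c * t powr (- \<alpha>))" by (simp add: c'_def)
    also have "\<dots> \<le> (q - \<eta>) * relaxation K t" using c(3)[OF t] \<eta> by (intro mult_left_mono) auto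
    finally show "c' * t powr (- \<alpha>) \<le> q - sol \<eta> t" using lower[of t] t0 by simp
    have "(q - \<eta>) * relaxation k t \<le> (q - \<eta>) * (\<alpha> / k * t powr (- \<alpha>))"
      using relaxation_upper_rate[OF k t0] \<eta> by (intro mult_left_mono) auto
    then show "q - sol \<eta> t \<le> C * t powr (- \<alpha>)" using upper[of t] t0 by (simp add: C_def)
  qed
  have abs: "\<bar>sol \<eta> t - q\<bar> = q - sol \<eta> t" if "T \<le> t" for t
  proof -
    have "0 \<le> c' * t powr (- \<alpha>)" using pos by simp
    with bounds(1)[OF that] show ?thesis by simp
  qed
  show "rate_of_convergence \<alpha> (sol \<eta>) q"
    unfolding rate_of_convergence_def using pos c(2) bounds abs by metis
  have "((\<lambda>t. t powr (- \<alpha>)) \<longlongrightarrow> 0) at_top"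
    using order_pos by (intro tendsto_neg_powr filterlim_ident) auto
  then have "((\<lambda>t. C * t powr (- \<alpha>)) \<longlongrightarrow> 0) at_top" by (rule tendsto_mult_right_zero)
  then have "((\<lambda>t. sol \<eta> t - q) \<longlongrightarrow> 0) at_top"
  proof (rule Lim_null_comparison[rotated])
    show "\<forall>\<^sub>F t in at_top. norm (sol \<eta> t - q) \<le> C * t powr (- \<alpha>)"
      using eventually_ge_at_top[of T] by eventually_elim (use bounds abs in auto)
  qed
  then show "(sol \<eta> \<longlongrightarrow> q) at_top" by (simp add: LIM_zero_iff)
qed

lemma next_equilibrium_above:
  assumes "0 < G \<eta>"
  shows "\<exists>q>\<eta>. G q = 0 \<and> (\<forall>y. \<eta> \<le> y \<longrightarrow> y < q \<longrightarrow> 0 < G y)"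
proof -
  obtain R where R: "\<eta> < R" "G R < 0" using inward_radius by blast
  have "continuous_on {0..} (\<lambda>s. G (\<eta> + s))" by (intro field_compose_continuous continuous_intros)
  then obtain t where t: "0 < t" "G (\<eta> + t) = 0" "\<And>s. 0 \<le> s \<Longrightarrow> s < t \<Longrightarrow> 0 < G (\<eta> + s)"
    using first_zero[of "\<lambda>s. G (\<eta> + s)" "R - \<eta>"] assms R by auto
  have "0 < G y" if "\<eta> \<le> y" "y < \<eta> + t" for y using t(3)[of "y - \<eta>"] that by simp
  then show ?thesis using t by (intro exI[of _ "\<eta> + t"]) auto
qed

lemma converges_if_field_positive:
  assumes "0 < G \<eta>"
  shows "\<exists>q. G q = 0 \<and> (sol \<eta> \<longlongrightarrow> q) at_top \<and> rate_of_convergence \<alpha> (sol \<eta>) q"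
  using next_equilibrium_above[OF assms] converges_up_to_equilibrium by metis

lemma reflected: "dissipative_field \<alpha> (\<lambda>y. - G (- y))"
proof unfold_locales
  fix R
  obtain L where L: "L-lipschitz_on {-R..R} G" using locally_lipschitz by blast
  have "L-lipschitz_on {-R..R} (\<lambda>y. - G (- y))"
  proof (rule lipschitz_onI)
    fix x y assume "x \<in> {-R..R}" "y \<in> {-R..R}"
    then show "dist (- G (- x)) (- G (- y)) \<le> L * dist x y"
      using lipschitz_onD[OF L, of "- x" "- y"] by (simp add: dist_minus)
  qed (rule lipschitz_on_nonneg[OF L])
  then show "\<exists>L. L-lipschitz_on {-R..R} (\<lambda>y. - G (- y))" by blast
next
  obtain R where R: "\<And>y. R < \<bar>y\<bar> \<Longrightarrow> G y * y < 0" using inward by blast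
  have "- G (- y) * y < 0" if "R < \<bar>y\<bar>" for y using R[of "- y"] that by simp
  then show "\<exists>R. \<forall>y. R < \<bar>y\<bar> \<longrightarrow> - G (- y) * y < 0" by blast
next
  fix y assume "- G (- y) = 0"
  then obtain D where D: "D \<noteq> 0" "(G has_real_derivative D) (at (- y))" using hyperbolic[of "- y"] by auto
  then have "((\<lambda>y. - G (- y)) has_real_derivative D) (at y)"
    using DERIV_minus[of "\<lambda>y. G (- y)" "- D" y UNIV] by (simp add: DERIV_mirror)
  then show "\<exists>D. D \<noteq> 0 \<and> ((\<lambda>y. - G (- y)) has_real_derivative D) (at y)" using D by blast
qed

lemma sol_reflected:
  assumes "0 \<le> t" shows "dissipative_field.sol \<alpha> (\<lambda>y. - G (- y)) \<eta> t = - sol (- \<eta>) t"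
  using dissipative_field.sol_unique[OF reflected abel_solution_reflect[OF sol_solution] assms, of "- \<eta>"]
  by simp

lemma sol_reflected_eventually:
  "\<forall>\<^sub>F t in at_top. dissipative_field.sol \<alpha> (\<lambda>y. - G (- y)) \<eta> t = - sol (- \<eta>) t"
  using eventually_ge_at_top[of 0] by eventually_elim (rule sol_reflected)

lemma sol_converges:
  "\<exists>q. G q = 0 \<and> (sol \<eta> \<longlongrightarrow> q) at_top \<and> (G \<eta> \<noteq> 0 \<longrightarrow> rate_of_convergence \<alpha> (sol \<eta>) q)"
proof (cases "G \<eta>" "0 :: real" rule: linorder_cases)
  case equal
  have "\<forall>\<^sub>F t in at_top. \<eta> = sol \<eta> t"
    using eventually_ge_at_top[of 0] by eventually_elim (simp add: sol_equilibrium equal)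
  then have "(sol \<eta> \<longlongrightarrow> \<eta>) at_top" by (rule Lim_transform_eventually[rotated]) simp
  then show ?thesis using equal by blast
next
  case greater
  then show ?thesis using converges_if_field_positive by blast
next
  case less
  then have "0 < - G (- (- \<eta>))" by simp
  from dissipative_field.converges_if_field_positive[OF reflected this]
  obtain q where q: "G (- q) = 0" and lim: "(dissipative_field.sol \<alpha> (\<lambda>y. - G (- y)) (- \<eta>) \<longlongrightarrow> q) at_top"
    and rate: "rate_of_convergence \<alpha> (dissipative_field.sol \<alpha> (\<lambda>y. - G (- y)) (- \<eta>)) q" by auto
  have "((\<lambda>t. - sol (- (- \<eta>)) t) \<longlongrightarrow> q) at_top"
    by (rule Lim_transform_eventually[OF lim sol_reflected_eventually])
  then have "(sol \<eta> \<longlongrightarrow> - q) at_top" using tendsto_minus_cancel[of "sol \<eta>" "- q"] by simp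
  moreover have "rate_of_convergence \<alpha> (sol \<eta>) (- q)"
  proof -
    have "\<bar>sol \<eta> t - - q\<bar> = \<bar>dissipative_field.sol \<alpha> (\<lambda>y. - G (- y)) (- \<eta>) t - q\<bar>" if "0 < T" "T \<le> t" for t T
      using sol_reflected[of t "- \<eta>"] that by simp
    then show ?thesis using rate unfolding rate_of_convergence_def by metis
  qed
  ultimately show ?thesis using q by blast
qed

end

section \<open>Attractor and heteroclinic solutions\<close>

context dissipative_field begin

text \<open>
  The equilibria lie in a bounded interval, and a limit point of them would be an equilibrium with
  vanishing derivative.
\<close>

lemma finite_equilibria: "finite {y. G y = 0}"
proof (rule ccontr)
  assume inf: "infinite {y. G y = 0}"
  obtain R where R: "\<And>y. R < \<bar>y\<bar> \<Longrightarrow> G y * y < 0" using inward by blast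
  have sub: "{y. G y = 0} \<subseteq> {-R..R}"
  proof
    fix y assume "y \<in> {y. G y = 0}"
    then have "\<not> R < \<bar>y\<bar>" using R[of y] by auto
    then show "y \<in> {-R..R}" by auto
  qed
  obtain z where z: "z islimpt {y. G y = 0}"
    using Heine_Borel_imp_Bolzano_Weierstrass[OF compact_Icc inf sub] by blast
  have "closed {y. G y = 0}"
    using continuous_closed_preimage_constant[OF field_continuous closed_UNIV, of 0] by simp
  then have Gz: "G z = 0" using z by (auto simp: closed_limpt)
  then obtain D where D: "D \<noteq> 0" "(G has_real_derivative D) (at z)" using hyperbolic by blast
  then have "((\<lambda>y. (G y - G z) / (y - z)) \<longlongrightarrow> D) (at z)" by (simp add: has_field_derivative_iff)
  then have "\<forall>\<^sub>F y in at z. (G y - G z) / (y - z) \<noteq> 0" using D(1) by (rule tendsto_imp_eventually_ne)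
  then have "\<forall>\<^sub>F y in at z. y \<notin> {y. G y = 0}" by eventually_elim (use Gz in auto)
  with z show False by (simp add: islimpt_iff_eventually)
qed

lemma sol_image_interval:
  assumes "G p = 0" "G q = 0" "p \<le> q" "0 \<le> t"
  shows "(\<lambda>\<eta>. sol \<eta> t) ` {p..q} = {p..q}"
proof
  show "(\<lambda>\<eta>. sol \<eta> t) ` {p..q} \<subseteq> {p..q}"
    using sol_mono[of p _ t] sol_mono[of _ q t] sol_equilibrium[of _ t] assms by fastforce
  show "{p..q} \<subseteq> (\<lambda>\<eta>. sol \<eta> t) ` {p..q}"
    using sol_surj_between[of p q _ t] assms by fastforce
qed

text \<open>
  With \<open>B \<subseteq> [- R, R]\<close>, all solutions from \<open>B\<close> stay between the two solutions from \<open>- R\<close> and \<open>R\<close>, whose limits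
  lie in \<open>[p, q]\<close>; so the distances of these two solutions to their limits bound the distance to
  \<open>[p, q]\<close> uniformly on \<open>B\<close>.
\<close>

lemma sol_attracted:
  assumes sub: "{y. G y = 0} \<subseteq> {p..q}" and B: "B \<noteq> {}" "bounded B"
  shows "((\<lambda>t. SUP \<eta>\<in>B. ereal (infdist (sol \<eta> t) {p..q})) \<longlongrightarrow> 0) at_top"
proof -
  obtain R where R: "\<And>\<eta>. \<eta> \<in> B \<Longrightarrow> \<bar>\<eta>\<bar> \<le> R" using B(2) unfolding bounded_iff by force
  obtain z where z: "G z = 0" "(sol (- R) \<longlongrightarrow> z) at_top" using sol_converges by blast
  obtain w where w: "G w = 0" "(sol R \<longlongrightarrow> w) at_top" using sol_converges by blast
  have zw: "z \<in> {p..q}" "w \<in> {p..q}" using sub z w by auto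
  define e where "e t = \<bar>sol (- R) t - z\<bar> + \<bar>sol R t - w\<bar>" for t
  have "(e \<longlongrightarrow> \<bar>z - z\<bar> + \<bar>w - w\<bar>) at_top" unfolding e_def by (intro tendsto_intros z w)
  then have e: "((\<lambda>t. ereal (e t)) \<longlongrightarrow> 0) at_top" by (simp add: zero_ereal_def)
  have dist: "infdist (sol \<eta> t) {p..q} \<le> e t" if \<eta>: "\<eta> \<in> B" and t: "0 \<le> t" for \<eta> t
  proof -
    have ord: "sol (- R) t \<le> sol \<eta> t" "sol \<eta> t \<le> sol R t"
      using R[OF \<eta>] t by (auto intro!: sol_mono simp: abs_le_iff)
    define v where "v = max p (min q (sol \<eta> t))"
    have "v \<in> {p..q}" using zw by (auto simp: v_def)
    then have "infdist (sol \<eta> t) {p..q} \<le> dist (sol \<eta> t) v" by (rule infdist_le)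
    also have "\<dots> \<le> e t" using ord zw by (auto simp: v_def e_def dist_real_def abs_le_iff max_def min_def)
    finally show ?thesis .
  qed
  show ?thesis
  proof (rule tendsto_sandwich[OF _ _ tendsto_const e])
    obtain \<eta> where "\<eta> \<in> B" using B(1) by blast
    then have "0 \<le> (SUP \<eta>\<in>B. ereal (infdist (sol \<eta> t) {p..q}))" for t
      by (rule SUP_upper2) (simp add: infdist_nonneg)
    then show "\<forall>\<^sub>F t in at_top. 0 \<le> (SUP \<eta>\<in>B. ereal (infdist (sol \<eta> t) {p..q}))" by simp
    show "\<forall>\<^sub>F t in at_top. (SUP \<eta>\<in>B. ereal (infdist (sol \<eta> t) {p..q})) \<le> ereal (e t)"
      using eventually_ge_at_top[of 0] by eventually_elim (auto intro!: SUP_least dist)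
  qed
qed

text \<open>
  The starting point from which \<open>\<eta>\<close> is reached at time \<open>t\<close> stays above \<open>p\<close> by order preservation.  It
  falls below every \<open>\<xi> > p\<close>, because the solution from \<open>\<xi>\<close> tends to \<open>q\<close> and so ends up above \<open>\<eta>\<close>.
\<close>

lemma heteroclinic_up:
  assumes p: "G p = 0" and q: "G q = 0" and pos: "\<And>y. p < y \<Longrightarrow> y < q \<Longrightarrow> 0 < G y"
    and \<eta>: "p < \<eta>" "\<eta> < q"
  shows "\<And>t. 0 \<le> t \<Longrightarrow> \<exists>!\<zeta>. sol \<zeta> t = \<eta>"
    and "((\<lambda>t. THE \<zeta>. sol \<zeta> t = \<eta>) \<longlongrightarrow> p) at_top"
    and "(sol \<eta> \<longlongrightarrow> q) at_top"
proof -
  define start where "start t = (THE \<zeta>. sol \<zeta> t = \<eta>)" for t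
  show ex1: "\<exists>!\<zeta>. sol \<zeta> t = \<eta>" if "0 \<le> t" for t
    using sol_surj_between[of p q \<eta> t] sol_inj[OF that] p q \<eta> that by auto
  have start: "sol (start t) t = \<eta>" if "0 \<le> t" for t
    unfolding start_def using ex1[OF that] by (rule theI')
  have conv: "(sol \<xi> \<longlongrightarrow> q) at_top" if "p < \<xi>" "\<xi> < q" for \<xi>
    using that q pos by (intro converges_up_to_equilibrium) auto
  then show "(sol \<eta> \<longlongrightarrow> q) at_top" using \<eta> by blast
  have "(start \<longlongrightarrow> p) at_top"
  proof (rule order_tendstoI)
    fix y assume "y < p"
    show "\<forall>\<^sub>F t in at_top. y < start t"
      using eventually_ge_at_top[of 0]
    proof eventually_elim
      case (elim t)
      have "\<not> start t \<le> p"
        using sol_mono[of "start t" p t] start[OF elim] sol_equilibrium[OF p elim] \<eta> elim by auto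
      then show ?case using \<open>y < p\<close> by simp
    qed
  next
    fix y assume "p < y"
    define \<xi> where "\<xi> = min y \<eta>"
    have \<xi>: "p < \<xi>" "\<xi> < q" "\<xi> \<le> y" using \<open>p < y\<close> \<eta> by (auto simp: \<xi>_def)
    have "\<forall>\<^sub>F t in at_top. \<eta> < sol \<xi> t" using conv[OF \<xi>(1,2)] \<eta>(2) by (rule order_tendstoD(1))
    then show "\<forall>\<^sub>F t in at_top. start t < y" using eventually_ge_at_top[of 0]
    proof eventually_elim
      case (elim t)
      have "\<not> \<xi> \<le> start t" using sol_mono[of \<xi> "start t" t] start elim by auto
      then show ?case using \<xi> by simp
    qed
  qed
  then show "((\<lambda>t. THE \<zeta>. sol \<zeta> t = \<eta>) \<longlongrightarrow> p) at_top" by (simp add: start_def[abs_def])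
qed

lemma heteroclinic_down:
  assumes p: "G p = 0" and q: "G q = 0" and neg: "\<And>y. p < y \<Longrightarrow> y < q \<Longrightarrow> G y < 0"
    and \<eta>: "p < \<eta>" "\<eta> < q"
  shows "\<And>t. 0 \<le> t \<Longrightarrow> \<exists>!\<zeta>. sol \<zeta> t = \<eta>"
    and "((\<lambda>t. THE \<zeta>. sol \<zeta> t = \<eta>) \<longlongrightarrow> q) at_top"
    and "(sol \<eta> \<longlongrightarrow> p) at_top"
proof -
  interpret R: dissipative_field \<alpha> "\<lambda>y. - G (- y)" by (rule reflected)
  have Req: "R.sol \<zeta> t = - sol (- \<zeta>) t" if "0 \<le> t" for \<zeta> t by (rule sol_reflected[OF that])
  have pos: "0 < - G (- y)" if "- q < y" "y < - p" for y using neg[of "- y"] that by simp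
  have H: "\<And>t. 0 \<le> t \<Longrightarrow> \<exists>!\<zeta>. R.sol \<zeta> t = - \<eta>" "((\<lambda>t. THE \<zeta>. R.sol \<zeta> t = - \<eta>) \<longlongrightarrow> - q) at_top"
    "(R.sol (- \<eta>) \<longlongrightarrow> - p) at_top"
    using R.heteroclinic_up[of "- q" "- p" "- \<eta>"] pos p q \<eta> by auto
  show ex1: "\<exists>!\<zeta>. sol \<zeta> t = \<eta>" if t: "0 \<le> t" for t
  proof -
    obtain \<zeta> where "R.sol \<zeta> t = - \<eta>" using H(1)[OF t] by blast
    then have "sol (- \<zeta>) t = \<eta>" using Req[OF t] by simp
    then show ?thesis using sol_inj[OF t] by blast
  qed
  have the: "(THE \<zeta>. R.sol \<zeta> t = - \<eta>) = - (THE \<zeta>. sol \<zeta> t = \<eta>)" if t: "0 \<le> t" for t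
    using theI'[OF ex1[OF t]] by (intro the1_equality[OF H(1)[OF t]]) (simp add: Req[OF t])
  have "\<forall>\<^sub>F t in at_top. (THE \<zeta>. R.sol \<zeta> t = - \<eta>) = - (THE \<zeta>. sol \<zeta> t = \<eta>)"
    using eventually_ge_at_top[of 0] by eventually_elim (rule the)
  from Lim_transform_eventually[OF H(2) this]
  show "((\<lambda>t. THE \<zeta>. sol \<zeta> t = \<eta>) \<longlongrightarrow> q) at_top" by (rule tendsto_minus_cancel)
  have "\<forall>\<^sub>F t in at_top. R.sol (- \<eta>) t = - sol \<eta> t"
    using eventually_ge_at_top[of 0] by eventually_elim (simp add: Req)
  from Lim_transform_eventually[OF H(3) this]
  show "(sol \<eta> \<longlongrightarrow> p) at_top" by (rule tendsto_minus_cancel)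
qed

lemma field_sign_between_equilibria:
  assumes "\<And>y. p < y \<Longrightarrow> y < q \<Longrightarrow> G y \<noteq> 0"
  shows "(\<forall>y. p < y \<longrightarrow> y < q \<longrightarrow> 0 < G y) \<or> (\<forall>y. p < y \<longrightarrow> y < q \<longrightarrow> G y < 0)"
proof (rule ccontr)
  assume "\<not> ?thesis"
  then obtain x y where xy: "p < x" "x < q" "G x < 0" "p < y" "y < q" "0 < G y"
    using assms by (metis linorder_neqE_linordered_idom)
  have "\<exists>z. min x y \<le> z \<and> z \<le> max x y \<and> G z = 0"
    using IVT'[of G x 0 y] IVT2'[of G x 0 y] field_continuous xy by (cases "x \<le> y") auto
  then show False using assms xy by (auto simp: min_le_iff_disj le_max_iff_disj)
qed

end

section \<open>The Caputo equation\<close>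

lemma caputo_solution_iff_abel_solution:
  "caputo_solution \<alpha> g \<eta> y \<longleftrightarrow> abel_solution \<alpha> (\<lambda>y. g y / Gamma \<alpha>) \<eta> y"
proof -
  have "(\<lambda>s. (t - s) powr (\<alpha> - 1) * (g (y s) / Gamma \<alpha>))
      = (\<lambda>s. 1 / Gamma \<alpha> * ((t - s) powr (\<alpha> - 1) * g (y s)))" for t
    by (simp add: fun_eq_iff)
  then have "abel_integral \<alpha> (\<lambda>s. g (y s) / Gamma \<alpha>) t
      = 1 / Gamma \<alpha> * integral {0..t} (\<lambda>s. (t - s) powr (\<alpha> - 1) * g (y s))" for t
    unfolding abel_integral_def by (simp only: integral_mult_right)
  then show ?thesis by (simp add: caputo_solution_def abel_solution_def)
qed

lemma dissipative_field_of_caputo: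
  fixes g :: "real \<Rightarrow> real"
  assumes alpha: "0 < \<alpha>" "\<alpha> < 1"
    and smooth: "g C1_differentiable_on UNIV"
    and dissipative: "\<exists>a b. 0 < a \<and> 0 < b \<and> (\<forall>x. g x * x \<le> a - b * x\<^sup>2)"
    and nondegenerate: "\<forall>x\<in>zeros g. deriv g x \<noteq> 0"
  shows "dissipative_field \<alpha> (\<lambda>y. g y / Gamma \<alpha>)"
proof
  show "0 < \<alpha>" "\<alpha> < 1" by fact+
  have Gam: "0 < Gamma \<alpha>" using alpha by (intro Gamma_real_pos)
  obtain D where D: "\<And>x. (g has_real_derivative D x) (at x)" and Dc: "continuous_on UNIV D"
    using smooth by (auto simp: C1_differentiable_on_def has_real_derivative_iff_has_vector_derivative)
  show "\<exists>L. L-lipschitz_on {-R..R} (\<lambda>y. g y / Gamma \<alpha>)" for R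
  proof -
    have "compact (D ` {-R..R})"
      by (intro compact_continuous_image continuous_on_subset[OF Dc]) auto
    then have "bounded (D ` {-R..R})" by (rule compact_imp_bounded)
    then obtain C where C: "\<And>x. x \<in> {-R..R} \<Longrightarrow> \<bar>D x\<bar> \<le> C"
      unfolding bounded_iff by force
    have "\<bar>g x / Gamma \<alpha> - g y / Gamma \<alpha>\<bar> \<le> max C 0 / Gamma \<alpha> * \<bar>x - y\<bar>" if "x \<in> {-R..R}" "y \<in> {-R..R}" for x y
    proof -
      have "\<bar>g x - g y\<bar> \<le> max C 0 * \<bar>x - y\<bar>"
        using field_differentiable_bound[of "{-R..R}" g D "max C 0" x y] that C D
        by (auto intro: has_field_derivative_at_within simp: le_max_iff_disj)
      then show ?thesis using Gam by (simp add: diff_divide_distrib[symmetric] divide_right_mono)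
    qed
    then have "(max C 0 / Gamma \<alpha>)-lipschitz_on {-R..R} (\<lambda>y. g y / Gamma \<alpha>)"
      using Gam by (intro lipschitz_onI) (auto simp: dist_real_def)
    then show ?thesis by blast
  qed
  obtain a b where ab: "0 < a" "0 < b" "\<And>x. g x * x \<le> a - b * x\<^sup>2" using dissipative by blast
  show "\<exists>R. \<forall>y. R < \<bar>y\<bar> \<longrightarrow> g y / Gamma \<alpha> * y < 0"
  proof (intro exI allI impI)
    fix y assume "sqrt (a / b) < \<bar>y\<bar>"
    then have "a / b < y\<^sup>2" using real_less_rsqrt[of "a / b"] real_sqrt_less_iff[of "a / b" "y\<^sup>2"] by simp
    then have "g y * y < 0" using ab(3)[of y] ab(2) by (simp add: field_simps)
    then show "g y / Gamma \<alpha> * y < 0" using Gam by (simp add: divide_neg_pos)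
  qed
  fix y assume "g y / Gamma \<alpha> = 0"
  then have "g y = 0" using Gam by simp
  then have "D y \<noteq> 0" using nondegenerate DERIV_imp_deriv[OF D[of y]] by (auto simp: zeros_def)
  moreover have "((\<lambda>y. g y / Gamma \<alpha>) has_real_derivative D y / Gamma \<alpha>) (at y)"
    by (intro DERIV_cdivide D)
  ultimately show "\<exists>D. D \<noteq> 0 \<and> ((\<lambda>y. g y / Gamma \<alpha>) has_real_derivative D) (at y)"
    using Gam by (intro exI[of _ "D y / Gamma \<alpha>"]) auto
qed

theorem theorem2p2:
  fixes \<alpha> :: real and g :: "real \<Rightarrow> real"
  assumes alpha: "0 < \<alpha>" "\<alpha> < 1"
    and smooth: "g C1_differentiable_on UNIV"
    and dissipative: "\<exists>a b. 0 < a \<and> 0 < b \<and> (\<forall>x. g x * x \<le> a - b * x\<^sup>2)"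
    and nondegenerate: "\<forall>x\<in>zeros g. deriv g x \<noteq> 0"
  shows "global_attractor (caputo_flow \<alpha> g) {Min (zeros g)..Max (zeros g)}
    \<and> (\<forall>\<eta>. \<exists>xstar\<in>zeros g. ((\<lambda>t. caputo_flow \<alpha> g t \<eta>) \<longlongrightarrow> xstar) at_top
          \<and> (\<eta> \<notin> zeros g \<longrightarrow> rate_of_convergence \<alpha> (\<lambda>t. caputo_flow \<alpha> g t \<eta>) xstar))
    \<and> (\<forall>p\<in>zeros g. \<forall>q\<in>zeros g. p < q \<and> zeros g \<inter> {p<..<q} = {} \<longrightarrow>
          (\<exists>\<eta>\<in>{p<..<q}. (\<forall>t. caputo_defined \<alpha> g t \<eta>)
             \<and> (((\<lambda>t. caputo_flow \<alpha> g t \<eta>) \<longlongrightarrow> p) at_bot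
                  \<and> ((\<lambda>t. caputo_flow \<alpha> g t \<eta>) \<longlongrightarrow> q) at_top
                \<or> ((\<lambda>t. caputo_flow \<alpha> g t \<eta>) \<longlongrightarrow> q) at_bot
                  \<and> ((\<lambda>t. caputo_flow \<alpha> g t \<eta>) \<longlongrightarrow> p) at_top)))"
proof -
  define G where "G = (\<lambda>y. g y / Gamma \<alpha>)"
  interpret dissipative_field \<alpha> G
    unfolding G_def using assms by (rule dissipative_field_of_caputo)
  have Gam: "0 < Gamma \<alpha>" using alpha by (intro Gamma_real_pos)
  have zeros: "zeros g = {y. G y = 0}" using Gam by (auto simp: zeros_def G_def)
  have solution: "caputo_solution \<alpha> g \<eta> y \<longleftrightarrow> abel_solution \<alpha> G \<eta> y" for \<eta> y
    unfolding G_def by (rule caputo_solution_iff_abel_solution)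
  have value_iff: "caputo_value \<alpha> g t \<eta> v \<longleftrightarrow> (if 0 \<le> t then v = sol \<eta> t else sol v (- t) = \<eta>)" for t \<eta> v
    unfolding caputo_value_def solution using sol_unique sol_solution by fastforce
  have flow: "caputo_flow \<alpha> g t \<eta> = sol \<eta> t" if "0 \<le> t" for t \<eta>
    using that by (simp add: caputo_flow_def value_iff)
  have flow_neg: "caputo_flow \<alpha> g (- t) \<eta> = (THE \<zeta>. sol \<zeta> t = \<eta>)" if "0 < t" for t \<eta>
    using that by (simp add: caputo_flow_def value_iff)
  have flow_eventually: "\<forall>\<^sub>F t in at_top. sol \<eta> t = caputo_flow \<alpha> g t \<eta>" for \<eta>
    using eventually_ge_at_top[of 0] by eventually_elim (simp add: flow)
  have flow_lim: "((\<lambda>t. caputo_flow \<alpha> g t \<eta>) \<longlongrightarrow> z) at_top" if "(sol \<eta> \<longlongrightarrow> z) at_top" for \<eta> z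
    by (rule Lim_transform_eventually[OF that flow_eventually])
  have flow_lim_bot: "((\<lambda>t. caputo_flow \<alpha> g t \<eta>) \<longlongrightarrow> z) at_bot"
    if "((\<lambda>t. THE \<zeta>. sol \<zeta> t = \<eta>) \<longlongrightarrow> z) at_top" for \<eta> z
    unfolding filterlim_at_bot_mirror
  proof (rule Lim_transform_eventually[OF that])
    show "\<forall>\<^sub>F t in at_top. (THE \<zeta>. sol \<zeta> t = \<eta>) = caputo_flow \<alpha> g (- t) \<eta>"
      using eventually_gt_at_top[of 0] by eventually_elim (simp add: flow_neg)
  qed
  define m where "m = Min (zeros g)"
  define M where "M = Max (zeros g)"
  have fin: "finite (zeros g)" using finite_equilibria by (simp add: zeros)
  have ne: "zeros g \<noteq> {}" using sol_converges[of 0] by (auto simp: zeros)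
  have mM: "G m = 0" "G M = 0" "m \<le> M" "{y. G y = 0} \<subseteq> {m..M}"
    using Min_in[OF fin ne] Max_in[OF fin ne] Min_le[OF fin] Max_ge[OF fin] by (auto simp: m_def M_def zeros)
  have attractor: "global_attractor (caputo_flow \<alpha> g) {m..M}"
    unfolding global_attractor_def
  proof (intro conjI allI impI)
    show "{m..M} \<noteq> {}" "compact {m..M}" using mM by auto
    show "caputo_flow \<alpha> g t ` {m..M} = {m..M}" if "0 \<le> t" for t
      using sol_image_interval[OF mM(1,2,3) that] by (simp add: flow[OF that])
    fix B :: "real set" assume B: "B \<noteq> {} \<and> bounded B"
    have "((\<lambda>t. SUP \<eta>\<in>B. ereal (infdist (sol \<eta> t) {m..M})) \<longlongrightarrow> 0) at_top"
      using B mM(4) by (intro sol_attracted) auto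
    then show "((\<lambda>t. SUP \<eta>\<in>B. ereal (infdist (caputo_flow \<alpha> g t \<eta>) {m..M})) \<longlongrightarrow> 0) at_top"
    proof (rule Lim_transform_eventually)
      show "\<forall>\<^sub>F t in at_top. (SUP \<eta>\<in>B. ereal (infdist (sol \<eta> t) {m..M}))
          = (SUP \<eta>\<in>B. ereal (infdist (caputo_flow \<alpha> g t \<eta>) {m..M}))"
        using eventually_ge_at_top[of 0] by eventually_elim (simp add: flow)
    qed
  qed
  have convergence: "\<exists>xstar\<in>zeros g. ((\<lambda>t. caputo_flow \<alpha> g t \<eta>) \<longlongrightarrow> xstar) at_top
          \<and> (\<eta> \<notin> zeros g \<longrightarrow> rate_of_convergence \<alpha> (\<lambda>t. caputo_flow \<alpha> g t \<eta>) xstar)" for \<eta>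
  proof -
    obtain z where z: "G z = 0" "(sol \<eta> \<longlongrightarrow> z) at_top" "G \<eta> \<noteq> 0 \<longrightarrow> rate_of_convergence \<alpha> (sol \<eta>) z"
      using sol_converges by blast
    have "rate_of_convergence \<alpha> (\<lambda>t. caputo_flow \<alpha> g t \<eta>) z" if "rate_of_convergence \<alpha> (sol \<eta>) z"
    proof -
      have "caputo_flow \<alpha> g t \<eta> = sol \<eta> t" if "0 < T" "T \<le> t" for t T using flow that by simp
      with that show ?thesis unfolding rate_of_convergence_def by metis
    qed
    then show ?thesis using z flow_lim[OF z(2)] by (auto simp: zeros)
  qed
  have heteroclinic: "\<exists>\<eta>\<in>{p<..<q}. (\<forall>t. caputo_defined \<alpha> g t \<eta>)
             \<and> (((\<lambda>t. caputo_flow \<alpha> g t \<eta>) \<longlongrightarrow> p) at_bot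
                  \<and> ((\<lambda>t. caputo_flow \<alpha> g t \<eta>) \<longlongrightarrow> q) at_top
                \<or> ((\<lambda>t. caputo_flow \<alpha> g t \<eta>) \<longlongrightarrow> q) at_bot
                  \<and> ((\<lambda>t. caputo_flow \<alpha> g t \<eta>) \<longlongrightarrow> p) at_top)"
    if "p \<in> zeros g" "q \<in> zeros g" "p < q" "zeros g \<inter> {p<..<q} = {}" for p q
  proof
    define \<eta> where "\<eta> = (p + q) / 2"
    have \<eta>: "p < \<eta>" "\<eta> < q" using that by (auto simp: \<eta>_def)
    then show "\<eta> \<in> {p<..<q}" by simp
    have pq: "G p = 0" "G q = 0" using that by (auto simp: zeros)
    have "G y \<noteq> 0" if "p < y" "y < q" for y using \<open>zeros g \<inter> {p<..<q} = {}\<close> that by (auto simp: zeros)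
    from field_sign_between_equilibria[OF this]
    consider "\<forall>y. p < y \<longrightarrow> y < q \<longrightarrow> 0 < G y" | "\<forall>y. p < y \<longrightarrow> y < q \<longrightarrow> G y < 0" by blast
    then have H: "(\<forall>t\<ge>0. \<exists>!\<zeta>. sol \<zeta> t = \<eta>) \<and>
        (((\<lambda>t. THE \<zeta>. sol \<zeta> t = \<eta>) \<longlongrightarrow> p) at_top \<and> (sol \<eta> \<longlongrightarrow> q) at_top
          \<or> ((\<lambda>t. THE \<zeta>. sol \<zeta> t = \<eta>) \<longlongrightarrow> q) at_top \<and> (sol \<eta> \<longlongrightarrow> p) at_top)"
    proof cases
      case 1
      then have "0 < G y" if "p < y" "y < q" for y using that by blast
      from heteroclinic_up[OF pq this \<eta>] show ?thesis by blast
    next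
      case 2
      then have "G y < 0" if "p < y" "y < q" for y using that by blast
      from heteroclinic_down[OF pq this \<eta>] show ?thesis by blast
    qed
    have "caputo_defined \<alpha> g t \<eta>" for t
      unfolding caputo_defined_def value_iff using H by (cases "0 \<le> t") auto
    then show "(\<forall>t. caputo_defined \<alpha> g t \<eta>)
             \<and> (((\<lambda>t. caputo_flow \<alpha> g t \<eta>) \<longlongrightarrow> p) at_bot
                  \<and> ((\<lambda>t. caputo_flow \<alpha> g t \<eta>) \<longlongrightarrow> q) at_top
                \<or> ((\<lambda>t. caputo_flow \<alpha> g t \<eta>) \<longlongrightarrow> q) at_bot
                  \<and> ((\<lambda>t. caputo_flow \<alpha> g t \<eta>) \<longlongrightarrow> p) at_top)"
      using H flow_lim flow_lim_bot by blast
  qed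
  show ?thesis using attractor convergence heteroclinic unfolding m_def M_def by blast
qed

end
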